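(* Let $n\ge 1$. (i) Let $M\colon \mathbb{R}^{n\times n}\to\mathbb{R}$ be a minor, and let $M^+=\max(M,0)$ and $M^-=\max(-M,0)$ be its positive and negative parts. Then $M^+$ and $M^-$ are extremal non-negative rank-one convex integrands in $\mathbb{R}^{n\times n}$. (ii) For each $k\in\{0,\dots,n\}$, the integrand $F_k\colon \mathbb{R}^{n\times n}_{\mathrm{sym}}\to\mathbb{R}$ defined by $$F_k(A)=\begin{cases}|\det A| & \text{if } A \text{ has index } k,\\ 0 & \text{otherwise,}\end{cases}$$ is an extremal non-negative rank-one convex integrand in $\mathbb{R}^{n\times n}_{\mathrm{sym}}$.
   Context: $\mathbb{R}^{n\times n}_{\mathrm{sym}}$ denotes the space of real symmetric $n\times n$ matrices. An integrand is a real-valued function on a space of matrices. A minor is a function $M(A)=\det\big((a_{i_p j_q})_{p,q=1}^s\big)$ for some $1\le s\le n$ and some fixed indices $i_1<\dots<i_s$, $j_1<\dots<j_s$ in $\{1,\dots,n\}$. The index of a symmetric matrix is the number of its negative eigenvalues (counted with multiplicity). Let $\mathbb{V}$ be either $\mathbb{R}^{n\times n}$ or $\mathbb{R}^{n\times n}_{\mathrm{sym}}$. An integrand $E\colon\mathbb{V}\to\mathbb{R}$ is rank-one convex if for all $A,X\in\mathbb{V}$ with $\operatorname{rank}X=1$ the function $t\mapsto E(A+tX)$ is convex on $\mathbb{R}$. A non-negative rank-one convex integrand $F\colon \mathbb{V}\to[0,\infty)$ is extremal (in $\mathbb{V}$) if, whenever $F=E_1+E_2$ with $E_1,E_2\colon\mathbb{V}\to[0,\infty)$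 non-negative rank-one convex integrands, each $E_i$ is a non-negative multiple of $F$. *)

theory Defs
  imports "HOL-Analysis.Analysis"
begin

text \<open>
  An integrand on a space \<open>V\<close> of \<open>n \<times> n\<close> matrices is a total function
  of which only the values on \<open>V\<close> matter.  Below, \<open>V\<close> is either \<^term>\<open>UNIV\<close>
  or \<open>sym_matrices\<close>.
\<close>

definition sym_matrices :: "(real^'n^'n) set" where
  "sym_matrices = {A. transpose A = A}"

definition rank_one_convex_on ::
    "(real^'n^'n) set \<Rightarrow> (real^'n^'n \<Rightarrow> real) \<Rightarrow> bool" where
  "rank_one_convex_on V E \<longleftrightarrow>
     (\<forall>A\<in>V. \<forall>X\<in>V. rank X = 1 \<longrightarrow> convex_on UNIV (\<lambda>t::real. E (A + t *\<^sub>R X)))"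

definition nonneg_rank_one_convex_on ::
    "(real^'n^'n) set \<Rightarrow> (real^'n^'n \<Rightarrow> real) \<Rightarrow> bool" where
  "nonneg_rank_one_convex_on V E \<longleftrightarrow> (\<forall>A\<in>V. 0 \<le> E A) \<and> rank_one_convex_on V E"

definition extremal_on ::
    "(real^'n^'n) set \<Rightarrow> (real^'n^'n \<Rightarrow> real) \<Rightarrow> bool" where
  "extremal_on V F \<longleftrightarrow>
     nonneg_rank_one_convex_on V F \<and>
     (\<forall>E1 E2. nonneg_rank_one_convex_on V E1 \<longrightarrow> nonneg_rank_one_convex_on V E2 \<longrightarrow>
        (\<forall>A\<in>V. F A = E1 A + E2 A) \<longrightarrow>
        (\<exists>c\<ge>0. \<forall>A\<in>V. E1 A = c * F A) \<and> (\<exists>c\<ge>0. \<forall>A\<in>V. E2 A = c * F A))"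

text \<open>
  The order \<open>s\<close> of the minor is the cardinality of the index type \<open>'s\<close>; the minor
  belongs to the row indices \<open>i p\<close> and the column indices \<open>j q\<close>, for strictly monotone
  \<open>i\<close> and \<open>j\<close>.
\<close>

definition minor ::
    "('s::{finite,linorder} \<Rightarrow> 'n::{finite,linorder}) \<Rightarrow> ('s \<Rightarrow> 'n) \<Rightarrow>
      real^('n::{finite,linorder})^'n::{finite,linorder} \<Rightarrow> real" where
  "minor i j A = det (\<chi> p q. A $ i p $ j q)"

definition eigenspace :: "real^'n^'n \<Rightarrow> real \<Rightarrow> (real^'n) set" where
  "eigenspace A l = {v. A *v v = l *\<^sub>R v}"

definition eigenvalues :: "real^'n^'n \<Rightarrow> real set" where
  "eigenvalues A = {l. \<exists>v. v \<noteq> 0 \<and> A *v v = l *\<^sub>R v}"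

text \<open>
  The index is only used for symmetric matrices, where the multiplicity of an eigenvalue
  (algebraic or geometric) is the dimension of its eigenspace.  The sum ranges over a
  finite set, since a matrix has only finitely many eigenvalues.
\<close>

definition matrix_index :: "real^'n^'n \<Rightarrow> nat" where
  "matrix_index A = (\<Sum>l\<in>{l\<in>eigenvalues A. l < 0}. dim (eigenspace A l))"

definition index_integrand :: "nat \<Rightarrow> real^'n^'n \<Rightarrow> real" where
  "index_integrand k A = (if matrix_index A = k then \<bar>det A\<bar> else 0)"

end

theory Submission
  imports Defs
begin

text \<open>
  Both parts rest on one observation. Let \<open>F = E1 + E2\<close>, and suppose that on a rank-one line
  \<open>F\<close> is a positive affine function up to the point where that function vanishes. On the half-line
  where the affine function is non-negative, two convex functions add up to an affine one, so both
  are affine. If the half-line has an end point, \<open>F\<close> vanishes there, hence so does \<open>E1\<close>; if it is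
  the whole line, \<open>F\<close> is constant there and \<open>E1\<close>, affine and bounded below, is constant too.
  In either case \<open>E1 / F\<close> is constant on the half-line
  (\<open>convex_summand_proportional\<close>). Hence \<open>F\<close> is extremal as soon as any two points of
  \<open>{F > 0}\<close> are joined by a chain of rank-one steps of this kind (\<open>extremal_onI\<close>), and the
  main work is to produce such chains.

  For a minor, entries outside the block can be changed one at a time without any effect, which
  leaves the question whether two invertible matrices with determinants of the same sign are joined
  by rank-one steps that preserve the sign. Chains can be multiplied by invertible matrices, and
  every invertible matrix is a product of matrices \<open>1 + u v\<^sup>T\<close>; each of these is joined either to
  the identity or to a fixed reflection, so the same is true of their product
  (\<open>joined_invertible\<close>, \<open>det_chain_connected\<close>).

  For the index, let \<open>definite_split U W\<close> be the set of symmetric matrices whose quadratic form is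
  positive definite on \<open>U\<close> and negative definite on \<open>W\<close>. If \<open>\<real>\<^sup>n = U \<oplus> W\<close>, this is a convex set of
  non-singular matrices of index \<open>dim W\<close>, and by the spectral theorem the non-singular matrices of
  index \<open>k\<close> are the union of these sets over all such splittings with \<open>dim W = k\<close>. Adding squares
  of linear forms that vanish on \<open>W\<close>, and subtracting squares of linear forms that vanish on \<open>U\<close>,
  stays in the set; after a large amount of this, any symmetric rank-one modifications of bounded
  total size become harmless, so any two elements of the set are joined
  (\<open>index_chain_definite_split\<close>). Two of these sets that share \<open>U\<close> or share \<open>W\<close> intersect
  (\<open>definite_splits_meet\<close>), and two subspaces of equal dimension have a common complement
  (\<open>common_complement\<close>); so one passes from any splitting to any other. On a line the determinant is
  affine and the index can change only where it vanishes, which gives the convexity of \<open>F\<^sub>k\<close> and the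
  behaviour of \<open>F\<^sub>k\<close> along each step.
\<close>

section \<open>Rank-one matrices\<close>

definition outer :: "real^'m \<Rightarrow> real^'n \<Rightarrow> real^'n^'m" where
  "outer u v = (\<chi> p q. u $ p * v $ q)"

lemma outer_mult_vec: "outer u v *v x = (v \<bullet> x) *\<^sub>R u"
  by (simp add: outer_def matrix_vector_mult_def inner_vec_def vec_eq_iff sum_distrib_left
      mult_ac)

lemma matrix_mult_outer: "(C::real^'m^'l) ** outer u v = outer (C *v u) v"
  by (simp add: outer_def matrix_matrix_mult_def matrix_vector_mult_def vec_eq_iff
      sum_distrib_left sum_distrib_right mult_ac)

lemma outer_mult_matrix: "outer u v ** (C::real^'l^'n) = outer u (v v* C)"
  by (simp add: outer_def matrix_matrix_mult_def vector_matrix_mult_def vec_eq_iff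
      sum_distrib_left mult_ac)

lemma matrix_add_rdistrib: "(A + B) ** C = A ** C + B ** (C :: real^'l^'n)"
  by (simp add: matrix_matrix_mult_def vec_eq_iff sum.distrib algebra_simps)

lemma outer_simps:
  "outer (c *\<^sub>R u) v = c *\<^sub>R outer u v" "outer u (c *\<^sub>R v) = c *\<^sub>R outer u v"
  "outer (- u) v = - outer u v" "outer u (- v) = - outer u v"
  "outer (u + u') v = outer u v + outer u' v" "outer u (v + v') = outer u v + outer u v'"
  "outer (u - u') v = outer u v - outer u' v" "outer u (v - v') = outer u v - outer u v'"
  "outer 0 v = 0" "outer u 0 = 0"
  by (simp_all add: outer_def vec_eq_iff algebra_simps)

lemma rank_outer_le: "rank (outer u v) \<le> 1"
proof -
  have "range ((*v) (outer u v)) \<subseteq> span {u}"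
    by (auto simp: outer_mult_vec span_singleton)
  then have "dim (range ((*v) (outer u v))) \<le> card {u}"
    by (intro dim_le_card) auto
  then show ?thesis by (simp add: rank_dim_range)
qed

lemma rank_le_1_outer:
  fixes X :: "real^'n^'m"
  assumes "rank X \<le> 1"
  obtains u v where "X = outer u v"
proof -
  let ?S = "range ((*v) X)"
  have "dim ?S \<le> 1" using assms by (simp add: rank_dim_range)
  moreover obtain B where B: "B \<subseteq> ?S" "independent B" "?S \<subseteq> span B" "card B = dim ?S"
    by (metis basis_exists)
  ultimately have "card B \<le> 1" "finite B" by (auto intro: independent_imp_finite)
  then have "B \<subseteq> {SOME b. b \<in> B}"
    by (metis card_le_Suc0_iff_eq One_nat_def singletonI someI subsetI)
  then obtain u where "?S \<subseteq> span {u}"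
    using B(3) span_mono by blast
  then have "\<forall>q. \<exists>c. X *v axis q 1 = c *\<^sub>R u"
    by (auto simp: span_singleton image_subset_iff)
  then obtain c where c: "\<And>q. X *v axis q 1 = c q *\<^sub>R u" by metis
  have "X $ p $ q = (X *v axis q 1) $ p" for p q
    by (simp add: matrix_vector_mult_basis column_def)
  then have "X = outer u (\<chi> q. c q)"
    by (simp add: c outer_def vec_eq_iff)
  then show ?thesis by (rule that)
qed

text \<open>
  An orthogonal change of basis turns \<open>u\<close> into a multiple of an axis vector; then only one row of
  the matrix depends on \<open>t\<close>.
\<close>

lemma det_add_outer_affine:
  fixes A :: "real^'n^'n"
  obtains b where "\<And>t. det (A + t *\<^sub>R outer u v) = det A + b * t"
proof (cases "u = 0")
  case True
  then show ?thesis using that[of 0] by (simp add: outer_simps)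
next
  case False
  define k :: 'n where "k = undefined"
  have "norm (u /\<^sub>R norm u) = 1" using False by simp
  then obtain Q :: "real^'n^'n" where Q: "orthogonal_matrix Q" "Q *v axis k 1 = u /\<^sub>R norm u"
    using orthogonal_matrix_exists_basis by metis
  define P where "P = transpose Q"
  have "P ** Q = mat 1" using Q(1) by (simp add: P_def orthogonal_matrix_def)
  then have PQ: "P *v (Q *v axis k 1) = axis k 1"
    by (simp add: matrix_vector_mul_assoc)
  have "P *v u = norm u *\<^sub>R (P *v (u /\<^sub>R norm u))"
    using False by (simp add: matrix_vector_mult_scaleR)
  then have Pu: "P *v u = norm u *\<^sub>R axis k 1" using Q(2) PQ by simp
  have dP: "det P \<noteq> 0"
    using \<open>P ** Q = mat 1\<close> by (metis det_I det_mul mult_zero_left zero_neq_one)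
  let ?B = "P ** A"
  let ?D = "det (\<chi> i. if i = k then v else ?B $ i)"
  have "det P * det (A + t *\<^sub>R outer u v) = det P * det A + (norm u * ?D) * t" for t
  proof -
    have "P ** (A + t *\<^sub>R outer u v) = ?B + t *\<^sub>R outer (P *v u) v"
      by (metis matrix_add_ldistrib matrix_mult_outer matrix_vector_mult_scaleR outer_simps(1))
    also have "\<dots> = (\<chi> i. if i = k then ?B $ i + (t * norm u) *s v else ?B $ i)"
      by (auto simp: Pu outer_def vec_eq_iff axis_def)
    finally have "det (P ** (A + t *\<^sub>R outer u v))
        = det (\<chi> i. if i = k then ?B $ i else ?B $ i)
          + det (\<chi> i. if i = k then (t * norm u) *s v else ?B $ i)"
      by (simp only: det_row_add)
    also have "det (\<chi> i. if i = k then (t * norm u) *s v else ?B $ i) = (t * norm u) * ?D"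
      by (simp only: det_row_mul)
    finally show ?thesis by (simp add: det_mul mult_ac)
  qed
  then have "det (A + t *\<^sub>R outer u v) = det A + (norm u * ?D / det P) * t" for t
    using dP by (simp add: field_simps)
  then show ?thesis by (rule that)
qed

text \<open>
  The determinant is affine along \<open>1 + t u v\<^sup>T\<close>, so it is enough to know where it vanishes. If
  \<open>u \<bullet> v \<noteq> 0\<close>, the matrix kills \<open>u\<close> at \<open>t = - 1 / (u \<bullet> v)\<close>; if \<open>u \<bullet> v = 0\<close>, it always has the
  inverse \<open>1 - t u v\<^sup>T\<close>, and an affine function without zeros is constant.
\<close>

lemma det_mat_1_add_outer: "det (mat 1 + outer u (v::real^'n)) = 1 + u \<bullet> v"
proof -
  obtain b where b: "\<And>t. det (mat 1 + t *\<^sub>R outer u v) = 1 + b * t"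
    using det_add_outer_affine[of "mat 1" u v] by (metis det_I)
  have "b = u \<bullet> v"
  proof (cases "u \<bullet> v = 0")
    case True
    have "b = 0"
    proof (rule ccontr)
      assume "b \<noteq> 0"
      have "(mat 1 + t *\<^sub>R outer u v) ** (mat 1 - t *\<^sub>R outer u v) = mat 1" for t
        using True by (simp add: matrix_eq outer_mult_vec inner_commute
            matrix_vector_mul_assoc[symmetric] scaleR_matrix_vector_assoc[symmetric]
            matrix_vector_mult_add_rdistrib matrix_vector_mult_diff_rdistrib algebra_simps inner_diff_right)
      then have "det (mat 1 + t *\<^sub>R outer u v) \<noteq> 0" for t
        by (metis det_I det_mul mult_zero_left zero_neq_one)
      from this[of "- 1 / b"] show False using \<open>b \<noteq> 0\<close> b[of "- 1 / b"] by simp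
    qed
    with True show ?thesis by simp
  next
    case False
    then have "u \<noteq> 0" by auto
    let ?T = "mat 1 + (- 1 / (u \<bullet> v)) *\<^sub>R outer u v"
    have "?T *v u = 0" using False
      by (simp add: matrix_vector_mult_add_rdistrib matrix_vector_mult_diff_rdistrib
          scaleR_matrix_vector_assoc[symmetric] outer_mult_vec inner_commute)
    with \<open>u \<noteq> 0\<close> have "det ?T = 0"
      by (metis invertible_det_nz invertible_def matrix_left_invertible_ker)
    then show ?thesis using False b[of "- 1 / (u \<bullet> v)"] by (simp add: field_simps)
  qed
  with b[of 1] show ?thesis by simp
qed

section \<open>Extremality from rank-one chains\<close>

text \<open>
  Where \<open>g + h\<close> is affine, the convexity inequalities of \<open>g\<close> and \<open>h\<close> add up to an equality, so
  each of them is an equality. For \<open>b \<noteq> 0\<close>, both summands vanish at the zero of \<open>a + b * t\<close>, which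
  determines \<open>g\<close> up to a factor; for \<open>b = 0\<close>, \<open>g\<close> is affine on the whole line and non-negative, so
  it is constant.
\<close>

lemma convex_summand_proportional:
  fixes g h :: "real \<Rightarrow> real"
  assumes g: "convex_on UNIV g" "\<And>t. 0 \<le> g t" and h: "convex_on UNIV h" "\<And>t. 0 \<le> h t"
    and gh: "\<And>t. 0 \<le> a + b * t \<Longrightarrow> g t + h t = a + b * t"
    and a: "0 < a" and ab: "0 < a + b"
  shows "g 1 * a = g 0 * (a + b)"
proof -
  have affine: "g ((1 - l) * s + l * r) = (1 - l) * g s + l * g r"
    if "0 \<le> a + b * s" "0 \<le> a + b * r" "0 \<le> l" "l \<le> 1" for s r l
  proof -
    let ?m = "(1 - l) * s + l * r"
    have m: "a + b * ?m = (1 - l) * (a + b * s) + l * (a + b * r)" by (simp add: algebra_simps)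
    then have "0 \<le> a + b * ?m" using that by simp
    then have "g ?m + h ?m = (1 - l) * (g s + h s) + l * (g r + h r)"
      using that m by (simp add: gh)
    moreover have "g ?m \<le> (1 - l) * g s + l * g r" "h ?m \<le> (1 - l) * h s + l * h r"
      using convex_onD[OF g(1), of l s r] convex_onD[OF h(1), of l s r] that by simp_all
    ultimately show ?thesis by (simp add: algebra_simps)
  qed
  consider "b = 0" | "b > 0" | "b < 0" by linarith
  then show ?thesis
  proof cases
    case 1
    have le: "g s \<le> g r" if sr: "\<And>N. N > 1 \<Longrightarrow> \<exists>y. g r = (1 - 1 / N) * g s + 1 / N * g y" for s r
    proof (rule ccontr)
      assume "\<not> g s \<le> g r"
      \<comment> \<open>a point \<open>N\<close> times as far from \<open>s\<close> as \<open>r\<close>, where \<open>g\<close> would have to be negative\<close>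
      define N where "N = g s / (g s - g r) + 2"
      have "0 \<le> g s / (g s - g r)" using \<open>\<not> g s \<le> g r\<close> g(2)[of s] by simp
      then have "N > 1" by (simp add: N_def)
      then obtain y where "g r = (1 - 1 / N) * g s + 1 / N * g y" using sr by blast
      moreover have "0 \<le> 1 / N * g y" using g(2)[of y] \<open>N > 1\<close> by simp
      ultimately have "(1 - 1 / N) * g s \<le> g r" by linarith
      then have "N * (g s - g r) \<le> g s" using \<open>N > 1\<close> by (simp add: field_simps)
      moreover have "N * (g s - g r) = g s + 2 * (g s - g r)"
        using \<open>\<not> g s \<le> g r\<close> by (simp add: N_def field_simps)
      ultimately have "g s + 2 * (g s - g r) \<le> g s" by simp
      then show False using \<open>\<not> g s \<le> g r\<close> by simp
    qed
    have "g 0 \<le> g 1"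
    proof (rule le)
      fix N :: real assume "N > 1"
      then show "\<exists>y. g 1 = (1 - 1 / N) * g 0 + 1 / N * g y"
        using affine[of 0 N "1 / N"] 1 a by auto
    qed
    moreover have "g 1 \<le> g 0"
    proof (rule le)
      fix N :: real assume "N > 1"
      then show "\<exists>y. g 0 = (1 - 1 / N) * g 1 + 1 / N * g y"
        using affine[of 1 "1 - N" "1 / N"] 1 a
        by (intro exI[of _ "1 - N"]) (simp add: field_simps)
    qed
    ultimately show ?thesis using 1 by simp
  next
    case 2
    have "g (- a / b) = 0" using gh[of "- a / b"] g(2)[of "- a / b"] h(2)[of "- a / b"] 2 by simp
    moreover have "(1 - a / (a + b)) * (- a / b) + a / (a + b) * 1 = 0"
      using 2 a by (simp add: field_simps)
    ultimately have "g 0 = a / (a + b) * g 1"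
      using affine[of "- a / b" 1 "a / (a + b)"] 2 a by simp
    then show ?thesis using ab by (simp add: field_simps)
  next
    case 3
    have "g (- a / b) = 0" using gh[of "- a / b"] g(2)[of "- a / b"] h(2)[of "- a / b"] 3 by simp
    moreover have "(1 - (- b / a)) * 0 + (- b / a) * (- a / b) = 1"
      using 3 a by (simp add: field_simps)
    moreover have l: "0 \<le> - b / a" "- b / a \<le> 1" using 3 a ab by (simp_all add: field_simps)
    ultimately have "g 1 = (1 - (- b / a)) * g 0"
      using affine[of 0 "- a / b" "- b / a"] 3 a l by simp
    then show ?thesis using a by (simp add: field_simps)
  qed
qed

text \<open>
  The relation \<open>R\<close> collects rank-one steps along which \<open>F\<close> is affine until it reaches zero. The
  ratio of a summand to \<open>F\<close> is the same at both ends of such a step, and \<open>conn\<close> spreads it over all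
  of \<open>{F > 0}\<close>. Elsewhere \<open>F\<close> vanishes, and with it both non-negative summands.
\<close>

lemma extremal_onI:
  fixes V :: "(real^'n^'n) set" and R :: "real^'n^'n \<Rightarrow> real^'n^'n \<Rightarrow> bool"
  assumes F: "nonneg_rank_one_convex_on V F"
    and V: "\<And>A X t. A \<in> V \<Longrightarrow> X \<in> V \<Longrightarrow> A + t *\<^sub>R X \<in> V"
    and step: "\<And>A B. R A B \<Longrightarrow> A \<in> V \<and> B - A \<in> V \<and> rank (B - A) \<le> 1 \<and>
      (\<exists>a b. 0 < a \<and> 0 < a + b \<and> (\<forall>t. 0 \<le> a + b * t \<longrightarrow> F (A + t *\<^sub>R (B - A)) = a + b * t))"
    and conn: "\<And>A B. A \<in> V \<Longrightarrow> B \<in> V \<Longrightarrow> 0 < F A \<Longrightarrow> 0 < F B \<Longrightarrow> R\<^sup>*\<^sup>* A B"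
  shows "extremal_on V F"
proof -
  have main: "\<exists>c\<ge>0. \<forall>A\<in>V. E A = c * F A"
    if E: "nonneg_rank_one_convex_on V E" and E': "nonneg_rank_one_convex_on V E'"
      and sum: "\<And>A. A \<in> V \<Longrightarrow> F A = E A + E' A" for E E'
  proof -
    have nonneg: "0 \<le> E A" "0 \<le> E' A" if "A \<in> V" for A
      using E E' that by (auto simp: nonneg_rank_one_convex_on_def)
    have ratio: "0 < F A \<and> 0 < F B \<and> E B * F A = E A * F B" if R: "R A B" for A B
    proof -
      obtain a b where V': "A \<in> V" "B - A \<in> V" "rank (B - A) \<le> 1" and ab: "0 < a" "0 < a + b"
        and Ft: "\<And>t. 0 \<le> a + b * t \<Longrightarrow> F (A + t *\<^sub>R (B - A)) = a + b * t"
        using step[OF R] by blast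
      have F01: "F A = a" "F B = a + b" using Ft[of 0] Ft[of 1] ab by simp_all
      have inV: "A + t *\<^sub>R (B - A) \<in> V" for t using V V' by blast
      show ?thesis
      proof (cases "rank (B - A) = 0")
        case True
        then show ?thesis using F01 ab by (simp add: rank_eq_0)
      next
        case False
        with V' have "rank (B - A) = 1" by simp
        then have "convex_on UNIV (\<lambda>t. E (A + t *\<^sub>R (B - A)))"
          "convex_on UNIV (\<lambda>t. E' (A + t *\<^sub>R (B - A)))"
          using E E' V' by (auto simp: nonneg_rank_one_convex_on_def rank_one_convex_on_def)
        from convex_summand_proportional[OF this(1) _ this(2) _ _ ab] inV
        have "E (A + 1 *\<^sub>R (B - A)) * a = E (A + 0 *\<^sub>R (B - A)) * (a + b)"
          by (metis (no_types, lifting) Ft nonneg sum)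
        then show ?thesis using F01 ab by simp
      qed
    qed
    have chain: "E B * F A = E A * F B" if "R\<^sup>*\<^sup>* A B" for A B
      using that
    proof induction
      case (step B C)
      then have "F B * (E C * F A) = F B * (E A * F C)"
        using ratio[OF step(2)] by (metis (no_types, lifting) mult.commute mult.left_commute)
      then show ?case using ratio[OF step(2)] by simp
    qed simp
    have off: "E A = 0" if "A \<in> V" "\<not> 0 < F A" for A
      using nonneg[OF that(1)] sum[OF that(1)] that by simp
    show ?thesis
    proof (cases "\<exists>A\<in>V. 0 < F A")
      case True
      then obtain A where A: "A \<in> V" "0 < F A" by blast
      have "E B = E A / F A * F B" if "B \<in> V" for B
      proof (cases "0 < F B")
        case True
        with chain[OF conn[OF A(1) that A(2)]] A show ?thesis by (simp add: field_simps)
      next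
        case False
        moreover have "F B = 0" using off[OF that False] nonneg[OF that] sum[OF that] False by simp
        ultimately show ?thesis using off[OF that] by simp
      qed
      moreover have "0 \<le> E A / F A" using A nonneg by simp
      ultimately show ?thesis by blast
    next
      case False
      then show ?thesis using off by (intro exI[of _ 0]) auto
    qed
  qed
  show ?thesis
    unfolding extremal_on_def
  proof (intro conjI F allI impI)
    fix E1 E2
    assume *: "nonneg_rank_one_convex_on V E1" "nonneg_rank_one_convex_on V E2"
      "\<forall>A\<in>V. F A = E1 A + E2 A"
    show "\<exists>c\<ge>0. \<forall>A\<in>V. E1 A = c * F A" using main[OF *(1,2)] *(3) by blast
    show "\<exists>c\<ge>0. \<forall>A\<in>V. E2 A = c * F A" using main[OF *(2,1)] *(3) by (simp add: add.commute)
  qed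
qed

section \<open>Invertible matrices with determinants of the same sign\<close>

definition det_step :: "real^'n^'n \<Rightarrow> real^'n^'n \<Rightarrow> bool" where
  "det_step A B \<longleftrightarrow> 0 < det A * det B \<and> (\<exists>u v. B = A + outer u v)"

lemma det_step_sym: "det_step A B \<Longrightarrow> det_step B A"
  unfolding det_step_def
proof (elim conjE exE, intro conjI)
  fix u v assume "B = A + outer u v"
  then have "A = B + outer (- u) v" by (simp add: outer_simps)
  then show "\<exists>u v. A = B + outer u v" by blast
qed (simp add: mult.commute)

lemma det_chain_sym: "det_step\<^sup>*\<^sup>* A B \<Longrightarrow> det_step\<^sup>*\<^sup>* B A"
  by (induction rule: rtranclp_induct)
     (auto intro: det_step_sym converse_rtranclp_into_rtranclp)

lemma det_chain_sgn: "det_step\<^sup>*\<^sup>* A B \<Longrightarrow> sgn (det A) = sgn (det B)"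
  by (induction rule: rtranclp_induct)
     (auto simp: det_step_def zero_less_mult_iff sgn_if)

lemma det_chain_mult_left:
  assumes "det C \<noteq> 0" "det_step\<^sup>*\<^sup>* A B"
  shows "det_step\<^sup>*\<^sup>* (C ** A) (C ** B)"
  using assms(2)
proof induction
  case (step B B')
  from step(2) obtain u v where "0 < det B * det B'" "B' = B + outer u v"
    by (auto simp: det_step_def)
  moreover have "0 < (det C * det C) * (det B * det B')"
    using calculation(1) assms(1) by (metis mult_pos_pos not_real_square_gt_zero)
  then have "0 < det (C ** B) * det (C ** B')" by (simp add: det_mul mult_ac)
  moreover have "C ** (B + outer u v) = C ** B + outer (C *v u) v"
    by (simp add: matrix_add_ldistrib matrix_mult_outer)
  ultimately have "det_step (C ** B) (C ** B')"
    by (auto simp: det_step_def)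
  with step(3) show ?case by simp
qed simp

lemma det_chain_mult_right:
  assumes "det C \<noteq> 0" "det_step\<^sup>*\<^sup>* A B"
  shows "det_step\<^sup>*\<^sup>* (A ** C) (B ** C)"
  using assms(2)
proof induction
  case (step B B')
  from step(2) obtain u v where "0 < det B * det B'" "B' = B + outer u v"
    by (auto simp: det_step_def)
  moreover have "0 < (det C * det C) * (det B * det B')"
    using calculation(1) assms(1) by (metis mult_pos_pos not_real_square_gt_zero)
  then have "0 < det (B ** C) * det (B' ** C)" by (simp add: det_mul mult_ac)
  moreover have "(B + outer u v) ** C = B ** C + outer u (v v* C)"
    by (simp add: matrix_add_rdistrib outer_mult_matrix)
  ultimately have "det_step (B ** C) (B' ** C)"
    by (auto simp: det_step_def)
  with step(3) show ?case by simp
qed simp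

text \<open>
  The diagonal matrix with entry \<open>-1\<close> at \<open>k\<close> and \<open>1\<close> elsewhere, in the form \<open>1 + u v\<^sup>T\<close>. It
  represents the matrices of negative determinant, as the identity represents the others.
\<close>

definition reflection :: "'n \<Rightarrow> real^'n^'n" where
  "reflection k = mat 1 + outer (axis k 1) (- 2 *\<^sub>R axis k 1)"

lemma det_reflection: "det (reflection k) = -1"
  by (simp add: reflection_def det_mat_1_add_outer inner_axis_axis)

lemma reflection_square: "reflection k ** reflection k = mat 1"
proof -
  have "reflection k *v x = x - (2 * x $ k) *\<^sub>R axis k 1" for x :: "real^'a"
    by (simp add: reflection_def matrix_vector_mult_add_rdistrib outer_mult_vec inner_axis')
  then show ?thesis
    by (simp add: matrix_eq matrix_vector_mul_assoc[symmetric] axis_def)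
qed

definition joined_to_axis_reflection :: "'n \<Rightarrow> real^'n^'n \<Rightarrow> bool" where
  "joined_to_axis_reflection k A \<longleftrightarrow>
     det_step\<^sup>*\<^sup>* A (mat 1) \<or> det_step\<^sup>*\<^sup>* A (reflection k)"

text \<open>
  Chains are compatible with products, and \<open>{1, reflection k}\<close> is a group.
\<close>

lemma joined_mult:
  assumes "joined_to_axis_reflection k A" "joined_to_axis_reflection k B"
  shows "joined_to_axis_reflection k (A ** B)"
proof -
  have AB: "det_step\<^sup>*\<^sup>* (A ** B) (A' ** B')"
    if "det_step\<^sup>*\<^sup>* A A'" "det_step\<^sup>*\<^sup>* B B'" "det A' \<noteq> 0" "det B' \<noteq> 0" for A' B'
  proof -
    have "det B \<noteq> 0" using det_chain_sgn[OF that(2)] that(4) by (auto simp: sgn_if split: if_splits)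
    then show ?thesis
      using det_chain_mult_right[OF _ that(1), of B] det_chain_mult_left[OF that(3) that(2)] by simp
  qed
  show ?thesis
    using assms AB[of "mat 1" "mat 1"] AB[of "mat 1" "reflection k"] AB[of "reflection k" "mat 1"]
      AB[of "reflection k" "reflection k"]
    by (auto simp: joined_to_axis_reflection_def det_reflection reflection_square)
qed

text \<open>
  For \<open>1 + u \<bullet> v > 0\<close>, a single step leads to the identity. Otherwise \<open>u\<close> and \<open>v\<close> can be changed in
  turn as long as \<open>1 + u \<bullet> v\<close> stays negative, and the goal is to reach the pair \<open>axis k 1\<close>,
  \<open>- 2 *\<^sub>R axis k 1\<close> that defines the reflection. This goes through \<open>(u, w)\<close> and \<open>(axis k 1, w)\<close>
  with \<open>w\<close> a large negative multiple of \<open>u + axis k 1\<close>, provided that \<open>u $ k \<ge> 0\<close>; if it is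
  negative, replace \<open>(u, v)\<close> by \<open>(- u, - v)\<close>, which gives the same matrix.
\<close>

lemma joined_elementary:
  assumes "1 + u \<bullet> v \<noteq> 0"
  shows "joined_to_axis_reflection k (mat 1 + outer u v)"
proof (cases "1 + u \<bullet> v > 0")
  case True
  then have "det_step (mat 1) (mat 1 + outer u v)"
    by (auto simp: det_step_def det_mat_1_add_outer)
  then show ?thesis
    using det_step_sym by (auto simp: joined_to_axis_reflection_def)
next
  case False
  have neg: "det_step\<^sup>*\<^sup>* (mat 1 + outer u v) (reflection k)"
    if uv: "1 + u \<bullet> v < 0" and uk: "0 \<le> u $ k" for u v :: "real^'a"
  proof -
    have step: "det_step (mat 1 + outer x y) (mat 1 + outer x' y')"
      if "1 + x \<bullet> y < 0" "1 + x' \<bullet> y' < 0" "x = x' \<or> y = y'" for x y x' y' :: "real^'a"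
    proof -
      have "mat 1 + outer x' y' = (mat 1 + outer x y) + outer (x' - x) y + outer x' (y' - y)"
        by (simp add: outer_simps)
      then have "\<exists>a b. mat 1 + outer x' y' = mat 1 + outer x y + outer a b"
        using that(3) by (metis (no_types, opaque_lifting) add.right_neutral cancel_comm_monoid_add_class.diff_cancel outer_simps(9,10))
      then show ?thesis using that by (simp add: det_step_def det_mat_1_add_outer mult_neg_neg)
    qed
    have "u \<noteq> 0" using uv by auto
    then have u2: "0 < u \<bullet> u" by simp
    define T where "T = 2 / (u \<bullet> u) + 2"
    define w where "w = - T *\<^sub>R (u + axis k 1)"
    have "T * (u \<bullet> u) = 2 + 2 * (u \<bullet> u)" "0 \<le> T * u $ k" "2 \<le> T"
      using u2 uk by (auto simp: T_def field_simps)
    moreover have "u \<bullet> w = - (T * (u \<bullet> u) + T * u $ k)" "axis k 1 \<bullet> w = - (T * u $ k + T)"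
      by (simp_all add: w_def inner_add_right inner_axis inner_axis' inner_axis_axis algebra_simps)
    ultimately have "1 + u \<bullet> w < 0" "1 + axis k 1 \<bullet> w < 0"
      using u2 by linarith+
    then have "det_step (mat 1 + outer u v) (mat 1 + outer u w)"
      "det_step (mat 1 + outer u w) (mat 1 + outer (axis k 1) w)"
      "det_step (mat 1 + outer (axis k 1) w) (reflection k)"
      using step uv by (auto simp: reflection_def inner_axis_axis)
    then show ?thesis by (meson r_into_rtranclp rtranclp_trans)
  qed
  have "1 + u \<bullet> v < 0" using False assms by simp
  show ?thesis
  proof (cases "0 \<le> u $ k")
    case True
    with neg[OF \<open>1 + u \<bullet> v < 0\<close>] show ?thesis by (simp add: joined_to_axis_reflection_def)
  next
    case False
    with neg[of "- u" "- v"] \<open>1 + u \<bullet> v < 0\<close> show ?thesis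
      by (simp add: joined_to_axis_reflection_def outer_simps)
  qed
qed

text \<open>
  Elimination, one column at a time: \<open>D\<close> contains the columns in which the matrix may differ from
  the identity. To repair column \<open>m\<close>, let \<open>a\<close> be that column and multiply from the left by
  \<open>T = 1 + (e - a) v\<^sup>T\<close>, where \<open>v \<bullet> a = 1\<close>, so that \<open>a\<close> is mapped to the axis vector \<open>e\<close>, and \<open>v\<close> is
  supported on the columns not yet repaired, so that the others are left alone. Both \<open>T\<close> and its
  inverse are of the form \<open>1 + u v\<^sup>T\<close>.
\<close>

lemma joined_invertible:
  fixes A :: "real^'n^'n"
  assumes "det A \<noteq> 0"
  shows "joined_to_axis_reflection k A"
proof -
  have "joined_to_axis_reflection k A"
    if "finite D" "det A \<noteq> 0" "\<And>q. q \<notin> D \<Longrightarrow> A *v axis q 1 = axis q 1"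
    for D and A :: "real^'n^'n"
    using that
  proof (induction D arbitrary: A rule: finite_induct)
    case empty
    moreover have "A $ p $ q = (A *v axis q 1) $ p" for p q
      by (simp add: matrix_vector_mult_basis column_def)
    ultimately have "A = mat 1" by (simp add: vec_eq_iff mat_def axis_def)
    then show ?case by (simp add: joined_to_axis_reflection_def)
  next
    case (insert m D)
    let ?e = "axis m 1 :: real^'n"
    define a where "a = A *v ?e"
    \<comment> \<open>If \<open>a\<close> is supported on repaired columns, then \<open>A a = a = A e\<close>, against injectivity.\<close>
    have "\<exists>l\<in>insert m D. a $ l \<noteq> 0"
    proof (rule ccontr)
      assume none: "\<not> ?thesis"
      have "A *v a = (\<Sum>q\<in>UNIV. a $ q *\<^sub>R (A *v axis q 1))"
        by (simp only: matrix_mult_sum[of A a] matrix_vector_mult_basis scalar_mult_eq_scaleR)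
      also have "\<dots> = (\<Sum>q\<in>UNIV. a $ q *\<^sub>R axis q 1)"
      proof (intro sum.cong refl)
        fix q
        show "a $ q *\<^sub>R (A *v axis q 1) = a $ q *\<^sub>R axis q 1"
          using none insert.prems(2)[of q] by (cases "q \<in> insert m D") auto
      qed
      also have "\<dots> = a"
        using basis_expansion[of a] by (simp add: scalar_mult_eq_scaleR)
      finally have "A *v a = A *v ?e" by (simp add: a_def)
      then have "a = ?e"
        using \<open>det A \<noteq> 0\<close> by (metis invertible_det_nz inj_matrix_vector_mult injD)
      with none show False by (auto simp: axis_def)
    qed
    then obtain l where l: "l \<in> insert m D" "a $ l \<noteq> 0" by blast
    \<comment> \<open>\<open>v $ m \<noteq> 0\<close> is needed too, since \<open>det T = v $ m\<close>; this explains the second summand.\<close>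
    define v where "v = (if a $ m \<noteq> 0 then axis m (1 / a $ m) else axis l (1 / a $ l) + axis m 1)"
    have v: "v \<bullet> a = 1" "v $ m \<noteq> 0" "\<And>q. q \<notin> insert m D \<Longrightarrow> v $ q = 0"
      using l by (auto simp: v_def inner_add_left inner_axis') (auto simp: axis_def split: if_splits)
    define T where "T = mat 1 + outer (?e - a) v"
    define c where "c = v $ m"
    define S where "S = mat 1 + outer (?e - a) ((- 1 / c) *\<^sub>R v)"
    have ev: "(?e - a) \<bullet> v = c - 1"
      using v(1) by (simp add: inner_diff_left inner_axis' inner_commute[of a] c_def)
    then have detT: "det T = c" by (simp add: T_def det_mat_1_add_outer)
    have c: "c \<noteq> 0" using v by (simp add: c_def)
    have "S ** T = mat 1"
    proof -
      have Tx: "T *v x = x + (v \<bullet> x) *\<^sub>R (?e - a)" for x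
        by (simp add: T_def matrix_vector_mult_add_rdistrib outer_mult_vec)
      have Sx: "S *v x = x - (v \<bullet> x / c) *\<^sub>R (?e - a)" for x
        by (simp add: S_def matrix_vector_mult_add_rdistrib outer_mult_vec)
      have "v \<bullet> (T *v x) = v \<bullet> x * c" for x
        unfolding Tx inner_add_right inner_scaleR_right inner_commute[of v "?e - a"] ev
        by (simp add: algebra_simps)
      then have "S *v (T *v x) = x" for x
        using c unfolding Sx by (simp add: Tx)
      then show ?thesis by (simp add: matrix_eq matrix_vector_mul_assoc[symmetric])
    qed
    then have A: "A = S ** (T ** A)" by (simp add: matrix_mul_assoc)
    have "joined_to_axis_reflection k (T ** A)"
    proof (rule insert.IH)
      show "det (T ** A) \<noteq> 0" using detT c insert.prems by (simp add: det_mul)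
      fix q assume "q \<notin> D"
      show "(T ** A) *v axis q 1 = axis q 1"
      proof (cases "q = m")
        case True
        have "T *v a = ?e" using v(1) by (simp add: T_def matrix_vector_mult_add_rdistrib outer_mult_vec)
        then show ?thesis using True by (simp add: matrix_vector_mul_assoc[symmetric] a_def)
      next
        case False
        with \<open>q \<notin> D\<close> have "A *v axis q 1 = axis q 1" "v $ q = 0" using insert.prems v(3) by auto
        then show ?thesis
          by (simp add: matrix_vector_mul_assoc[symmetric] T_def matrix_vector_mult_add_rdistrib
              outer_mult_vec inner_axis)
      qed
    qed
    moreover have "joined_to_axis_reflection k S"
      unfolding S_def using ev c by (intro joined_elementary) (simp add: field_simps)
    ultimately show ?case using A joined_mult by metis
  qed
  from this[of UNIV] assms show ?thesis by simp
qed

lemma det_chain_connected: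
  fixes A B :: "real^'n^'n"
  assumes "0 < det A * det B"
  shows "det_step\<^sup>*\<^sup>* A B"
proof -
  define k :: 'n where "k = undefined"
  have "joined_to_axis_reflection k A" "joined_to_axis_reflection k B"
    using assms by (auto intro: joined_invertible)
  moreover have "sgn (det A) = sgn (det B)"
    using assms by (auto simp: zero_less_mult_iff)
  ultimately consider C where "det_step\<^sup>*\<^sup>* A C" "det_step\<^sup>*\<^sup>* B C"
    unfolding joined_to_axis_reflection_def
    using det_chain_sgn[of A "mat 1"] det_chain_sgn[of B "mat 1"]
      det_chain_sgn[of A "reflection k"] det_chain_sgn[of B "reflection k"]
    by (auto simp: det_reflection)
  then show ?thesis
    by cases (metis det_chain_sym rtranclp_trans)
qed

section \<open>Positive and negative parts of minors\<close>

definition submatrix ::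
    "('s \<Rightarrow> 'n) \<Rightarrow> ('s \<Rightarrow> 'n) \<Rightarrow> real^'n^'n \<Rightarrow> real^'s^'s" where
  "submatrix i j A = (\<chi> p q. A $ i p $ j q)"

text \<open>
  The section of \<open>submatrix i j\<close> that fills up with zeros.
\<close>

definition matrix_with_block ::
    "('s \<Rightarrow> 'n) \<Rightarrow> ('s \<Rightarrow> 'n) \<Rightarrow> real^'s^'s \<Rightarrow> real^'n^'n" where
  "matrix_with_block i j C =
     (\<chi> p q. if p \<in> range i \<and> q \<in> range j then C $ inv i p $ inv j q else 0)"

lemma minor_eq: "minor i j A = det (submatrix i j A)"
  by (simp add: minor_def submatrix_def)

lemma submatrix_with_block:
  "inj i \<Longrightarrow> inj j \<Longrightarrow> submatrix i j (matrix_with_block i j C) = C"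
  by (simp add: submatrix_def matrix_with_block_def vec_eq_iff)

lemma submatrix_add_outer:
  "submatrix i j (A + t *\<^sub>R outer u v) =
     submatrix i j A + t *\<^sub>R outer (\<chi> p. u $ i p) (\<chi> q. v $ j q)"
  by (simp add: submatrix_def outer_def vec_eq_iff)

lemma matrix_with_block_add_outer:
  "\<exists>u' v'. matrix_with_block i j (C + outer u v) = matrix_with_block i j C + outer u' v'"
  by (rule exI[of _ "\<chi> p. if p \<in> range i then u $ inv i p else 0"],
      rule exI[of _ "\<chi> q. if q \<in> range j then v $ inv j q else 0"])
     (simp add: matrix_with_block_def outer_def vec_eq_iff)

definition minor_step ::
    "('s::{finite,linorder} \<Rightarrow> 'n::{finite,linorder}) \<Rightarrow> ('s \<Rightarrow> 'n) \<Rightarrow>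
      real^('n::{finite,linorder})^'n::{finite,linorder} \<Rightarrow>
      real^('n::{finite,linorder})^'n::{finite,linorder} \<Rightarrow> bool" where
  "minor_step i j A B \<longleftrightarrow> 0 < minor i j A * minor i j B \<and> (\<exists>u v. B = A + outer u v)"

text \<open>
  The entries outside the block do not enter the minor, and replacing a single entry is a rank-one
  change.
\<close>

lemma minor_chain_same_submatrix:
  assumes eq: "submatrix i j A = submatrix i j B" and A: "minor i j A \<noteq> 0"
  shows "(minor_step i j)\<^sup>*\<^sup>* A B"
proof -
  define C where "C S = (\<chi> p q. if (p, q) \<in> S then B $ p $ q else A $ p $ q)" for S
  have sub: "submatrix i j (C S) = submatrix i j A" for S
    using eq by (simp add: submatrix_def C_def vec_eq_iff)
  have "(minor_step i j)\<^sup>*\<^sup>* A (C S)" if "finite S" for S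
    using that
  proof induction
    case empty
    have "C {} = A" by (simp add: C_def vec_eq_iff)
    then show ?case by simp
  next
    case (insert x S)
    obtain p q where x: "x = (p, q)" by (cases x)
    have "C (insert x S) = C S + outer (axis p 1) (axis q (B $ p $ q - A $ p $ q))"
      using insert(2) by (auto simp: x C_def outer_def vec_eq_iff axis_def)
    moreover have "0 < minor i j (C S) * minor i j (C (insert x S))"
      using A by (auto simp: minor_eq sub zero_less_mult_iff neq_iff)
    ultimately have "minor_step i j (C S) (C (insert x S))"
      unfolding minor_step_def by blast
    with insert.IH show ?case by simp
  qed
  from this[of UNIV] show ?thesis by (simp add: C_def)
qed

text \<open>
  Both matrices are joined to the matrices that keep only their blocks, and these are joined because
  a chain of blocks lifts to a chain of large matrices.
\<close>

lemma minor_chain_connected: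
  assumes inj: "inj i" "inj j" and AB: "0 < minor i j A * minor i j B"
  shows "(minor_step i j)\<^sup>*\<^sup>* A B"
proof -
  let ?e = "matrix_with_block i j"
  have "(minor_step i j)\<^sup>*\<^sup>* (?e C) (?e D)" if "det_step\<^sup>*\<^sup>* C D" for C D
    using that
  proof induction
    case (step D D')
    then have "minor_step i j (?e D) (?e D')"
      using matrix_with_block_add_outer[of i j D]
      by (auto simp: det_step_def minor_step_def minor_eq submatrix_with_block inj)
    with step show ?case by simp
  qed simp
  then have "(minor_step i j)\<^sup>*\<^sup>* (?e (submatrix i j A)) (?e (submatrix i j B))"
    using AB by (simp add: det_chain_connected minor_eq)
  moreover have "(minor_step i j)\<^sup>*\<^sup>* A (?e (submatrix i j A))"
    using AB by (intro minor_chain_same_submatrix) (auto simp: submatrix_with_block inj)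
  moreover have "(minor_step i j)\<^sup>*\<^sup>* (?e (submatrix i j B)) B"
    using AB by (intro minor_chain_same_submatrix) (auto simp: submatrix_with_block inj minor_eq)
  ultimately show ?thesis by (meson rtranclp_trans)
qed

lemma convex_on_max_affine: "convex_on UNIV (\<lambda>t::real. max (a + b * t) 0)"
proof (rule convex_onI)
  fix t x y :: real assume t: "0 < t" "t < 1"
  let ?m = "\<lambda>x. max (a + b * x) 0"
  have "a + b * ((1 - t) * x + t * y) = (1 - t) * (a + b * x) + t * (a + b * y)"
    by (simp add: algebra_simps)
  also have "\<dots> \<le> (1 - t) * ?m x + t * ?m y"
    using t by (intro add_mono mult_left_mono) auto
  finally have "a + b * ((1 - t) * x + t * y) \<le> (1 - t) * ?m x + t * ?m y" .
  moreover have "0 \<le> (1 - t) * ?m x + t * ?m y"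
    using t by (intro add_nonneg_nonneg mult_nonneg_nonneg) auto
  ultimately show "?m ((1 - t) *\<^sub>R x + t *\<^sub>R y) \<le> (1 - t) * ?m x + t * ?m y"
    by simp
qed simp

text \<open>
  The sign \<open>s\<close> selects the positive or the negative part.
\<close>

lemma minor_part_extremal:
  fixes s :: real and i j :: "'s::{finite,linorder} \<Rightarrow> 'n::{finite,linorder}"
  assumes inj: "inj i" "inj j" and s: "s = 1 \<or> s = -1"
  shows "extremal_on UNIV (\<lambda>A. max (s * minor i j A) 0)"
proof (rule extremal_onI[where R = "\<lambda>A B. minor_step i j A B \<and> 0 < s * minor i j A"])
  have line: "\<exists>b. \<forall>t. s * minor i j (A + t *\<^sub>R X) = s * minor i j A + b * t"
    if X1: "rank X \<le> 1" for A X
  proof -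
    obtain u v where X: "X = outer u v" using rank_le_1_outer[OF X1] by blast
    obtain b where "\<And>t. minor i j (A + t *\<^sub>R X) = minor i j A + b * t"
      unfolding minor_eq X submatrix_add_outer using det_add_outer_affine by blast
    then have "\<forall>t. s * minor i j (A + t *\<^sub>R X) = s * minor i j A + (s * b) * t"
      by (simp add: algebra_simps)
    then show ?thesis by blast
  qed
  show "nonneg_rank_one_convex_on UNIV (\<lambda>A. max (s * minor i j A) 0)"
    unfolding nonneg_rank_one_convex_on_def rank_one_convex_on_def
  proof (intro conjI ballI impI)
    fix A X :: "real^('n::{finite,linorder})^'n::{finite,linorder}" assume "rank X = 1"
    with line[of X A] obtain b where "\<And>t. s * minor i j (A + t *\<^sub>R X) = s * minor i j A + b * t"
      by auto
    then show "convex_on UNIV (\<lambda>t. max (s * minor i j (A + t *\<^sub>R X)) 0)"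
      by (simp add: convex_on_max_affine)
  qed simp
  fix A B :: "real^('n::{finite,linorder})^'n::{finite,linorder}"
  {
    assume R: "minor_step i j A B \<and> 0 < s * minor i j A"
    then have r: "rank (B - A) \<le> 1" using rank_outer_le by (auto simp: minor_step_def)
    then obtain b where b: "\<And>t. s * minor i j (A + t *\<^sub>R (B - A)) = s * minor i j A + b * t"
      using line by blast
    have "0 < s * minor i j B"
      using R s by (auto simp: minor_step_def zero_less_mult_iff)
    then have "0 < s * minor i j A + b" using b[of 1] by simp
    with r b R show "A \<in> UNIV \<and> B - A \<in> UNIV \<and> rank (B - A) \<le> 1 \<and>
      (\<exists>a b. 0 < a \<and> 0 < a + b \<and> (\<forall>t. 0 \<le> a + b * t \<longrightarrow>
        max (s * minor i j (A + t *\<^sub>R (B - A))) 0 = a + b * t))"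
      by (intro conjI exI[of _ "s * minor i j A"] exI[of _ b]) auto
  }
  {
    assume "0 < max (s * minor i j A) 0" "0 < max (s * minor i j B) 0"
    then have A: "0 < s * minor i j A" and B: "0 < s * minor i j B" by auto
    then have "0 < minor i j A * minor i j B" using s by (auto simp: zero_less_mult_iff)
    then have "(minor_step i j)\<^sup>*\<^sup>* A B" by (rule minor_chain_connected[OF inj])
    then have "(\<lambda>A B. minor_step i j A B \<and> 0 < s * minor i j A)\<^sup>*\<^sup>* A B \<and> 0 < s * minor i j B"
    proof induction
      case (step B C)
      then have "0 < s * minor i j C" using s by (auto simp: minor_step_def zero_less_mult_iff)
      with step show ?case by (auto intro: rtranclp.rtrancl_into_rtrancl)
    qed (use A in simp)
    then show "(\<lambda>A B. minor_step i j A B \<and> 0 < s * minor i j A)\<^sup>*\<^sup>* A B" ..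
  }
qed simp

section \<open>Spectral decomposition and index of symmetric matrices\<close>

lemma sym_matrices_inner:
  assumes "A \<in> sym_matrices"
  shows "x \<bullet> (A *v y) = (A *v x) \<bullet> y"
proof -
  have "x v* A = A *v x"
    using assms transpose_matrix_vector[of A x] by (simp add: sym_matrices_def)
  then show ?thesis using dot_lmul_matrix[of x A y] by simp
qed

lemma sym_quadratic_add:
  assumes "A \<in> sym_matrices"
  shows "(x + y) \<bullet> (A *v (x + y)) = x \<bullet> (A *v x) + 2 * (x \<bullet> (A *v y)) + y \<bullet> (A *v y)"
  using sym_matrices_inner[OF assms, of y x]
  by (simp add: matrix_vector_right_distrib inner_add_left inner_add_right inner_commute[of "A *v y"])

text \<open>
  A maximum point \<open>x\<close> of the quadratic form on the unit sphere of \<open>N\<close> is an eigenvector for the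
  maximal value \<open>l\<close>: moving from \<open>x\<close> in the direction of the residual \<open>r = A x - l x\<close> would increase
  the quotient to first order by \<open>2 (r \<bullet> r)\<close>, so \<open>r = 0\<close>.
\<close>

lemma sym_eigenvector_in_invariant_subspace:
  assumes A: "A \<in> sym_matrices" and N: "subspace N" "N \<noteq> {0}"
    and inv: "\<And>x. x \<in> N \<Longrightarrow> A *v x \<in> N"
  obtains x l where "x \<in> N" "x \<noteq> 0" "A *v x = l *\<^sub>R x"
proof -
  let ?S = "N \<inter> sphere 0 1"
  obtain z where z: "z \<in> N" "z \<noteq> 0" using N subspace_0 by blast
  then have "z /\<^sub>R norm z \<in> ?S" using N by (simp add: subspace_mul)
  moreover have "compact ?S" using closed_subspace[OF N(1)] by (simp add: closed_Int_compact)
  moreover have "continuous_on ?S (\<lambda>x. x \<bullet> (A *v x))"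
    by (intro continuous_intros linear_continuous_on linear_linear[THEN iffD2] matrix_vector_mul_linear)
  ultimately obtain x where x: "x \<in> ?S" and max: "\<And>y. y \<in> ?S \<Longrightarrow> y \<bullet> (A *v y) \<le> x \<bullet> (A *v x)"
    using continuous_attains_sup[of ?S "\<lambda>x. x \<bullet> (A *v x)"] by blast
  define l where "l = x \<bullet> (A *v x)"
  have bound: "y \<bullet> (A *v y) \<le> l * (y \<bullet> y)" if "y \<in> N" for y
  proof (cases "y = 0")
    case False
    with that N have "y /\<^sub>R norm y \<in> ?S" by (simp add: subspace_mul)
    from max[OF this] have "(y \<bullet> (A *v y)) / (norm y)\<^sup>2 \<le> l"
      by (simp add: l_def matrix_vector_mult_scaleR divide_simps power2_eq_square)
    then show ?thesis using False by (simp add: divide_simps power2_norm_eq_inner)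
  qed simp
  have xx: "x \<in> N" "x \<bullet> x = 1" "x \<noteq> 0" using x by (auto simp: norm_eq_1)
  define r where "r = A *v x - l *\<^sub>R x"
  have rN: "r \<in> N" using N xx inv by (simp add: r_def subspace_diff subspace_mul)
  \<comment> \<open>the second-order term of the defect \<open>l |y|\<^sup>2 - y \<bullet> A y\<close> along \<open>y = x + t r\<close>\<close>
  define q where "q = l * (r \<bullet> r) - r \<bullet> (A *v r)"
  have "2 * t * (r \<bullet> r) \<le> t\<^sup>2 * q" for t
  proof -
    have "x + t *\<^sub>R r \<in> N" using N xx rN by (simp add: subspace_add subspace_mul)
    moreover have "(x + t *\<^sub>R r) \<bullet> (A *v (x + t *\<^sub>R r))
        = l + 2 * t * (x \<bullet> (A *v r)) + t\<^sup>2 * (r \<bullet> (A *v r))"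
      by (subst sym_quadratic_add[OF A])
         (simp add: matrix_vector_mult_scaleR l_def power2_eq_square)
    moreover have "(x + t *\<^sub>R r) \<bullet> (x + t *\<^sub>R r) = 1 + 2 * t * (x \<bullet> r) + t\<^sup>2 * (r \<bullet> r)"
      by (simp add: inner_add_left inner_add_right xx power2_eq_square inner_commute[of r x] algebra_simps)
    ultimately
    have "l + 2 * t * (x \<bullet> (A *v r)) + t\<^sup>2 * (r \<bullet> (A *v r)) \<le> l * (1 + 2 * t * (x \<bullet> r) + t\<^sup>2 * (r \<bullet> r))"
      using bound by metis
    moreover have "x \<bullet> (A *v r) - l * (x \<bullet> r) = r \<bullet> r"
      by (subst sym_matrices_inner[OF A]) (simp add: r_def inner_diff_left)
    then have xr: "x \<bullet> (A *v r) = r \<bullet> r + l * (x \<bullet> r)" by simp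
    ultimately show ?thesis unfolding xr q_def by (simp add: algebra_simps)
  qed
  have "r \<bullet> r = 0"
  proof (rule ccontr)
    assume "r \<bullet> r \<noteq> 0"
    then have rr: "0 < r \<bullet> r" by (simp add: order_less_le)
    define t where "t = (r \<bullet> r) / (\<bar>q\<bar> + 1)"
    have t: "0 < t" "t * (\<bar>q\<bar> + 1) = r \<bullet> r" using rr by (simp_all add: t_def)
    have "t * (2 * (r \<bullet> r)) \<le> t * (t * q)" using \<open>\<And>t. 2 * t * (r \<bullet> r) \<le> t\<^sup>2 * q\<close>[of t]
      by (simp add: power2_eq_square mult_ac)
    then have "2 * (r \<bullet> r) \<le> t * q" using t(1) by simp
    also have "\<dots> \<le> t * (\<bar>q\<bar> + 1)" using t(1) by (intro mult_left_mono) auto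
    finally show False using t rr by simp
  qed
  then have "A *v x = l *\<^sub>R x" by (simp add: r_def)
  with xx show ?thesis by (intro that) auto
qed

lemma subspace_eigenspace: "subspace (eigenspace A l)"
  by (auto simp: subspace_def eigenspace_def matrix_vector_right_distrib matrix_vector_mult_scaleR
      scaleR_add_right)

lemma eigenspaces_orthogonal:
  assumes "A \<in> sym_matrices" "x \<in> eigenspace A l" "y \<in> eigenspace A m" "l \<noteq> m"
  shows "x \<bullet> y = 0"
proof -
  have "m * (x \<bullet> y) = l * (x \<bullet> y)"
    using sym_matrices_inner[OF assms(1), of x y] assms(2,3) by (simp add: eigenspace_def)
  with assms(4) show ?thesis by simp
qed

lemma finite_eigenvalues_sym:
  fixes A :: "real^'n^'n"
  assumes A: "A \<in> sym_matrices"
  shows "finite (eigenvalues A)"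
proof -
  have "\<forall>l\<in>eigenvalues A. \<exists>v. v \<noteq> 0 \<and> v \<in> eigenspace A l"
    by (auto simp: eigenvalues_def eigenspace_def)
  then obtain f where f: "\<And>l. l \<in> eigenvalues A \<Longrightarrow> f l \<noteq> 0 \<and> f l \<in> eigenspace A l"
    by metis
  have orth: "f l \<bullet> f m = 0" if "l \<in> eigenvalues A" "m \<in> eigenvalues A" "l \<noteq> m" for l m
    using eigenspaces_orthogonal[OF A] f that by blast
  then have "pairwise orthogonal (f ` eigenvalues A)"
    by (auto simp: pairwise_def orthogonal_def)
  then have "independent (f ` eigenvalues A)"
    using f by (intro pairwise_orthogonal_independent) auto
  then have "finite (f ` eigenvalues A)" by (rule independent_imp_finite)
  moreover have "inj_on f (eigenvalues A)"
  proof (rule inj_onI)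
    fix l m assume lm: "l \<in> eigenvalues A" "m \<in> eigenvalues A" "f l = f m"
    show "l = m"
    proof (rule ccontr)
      assume "l \<noteq> m"
      with orth[OF lm(1,2)] lm(3) have "f m \<bullet> f m = 0" by simp
      with f[OF lm(2)] show False by simp
    qed
  qed
  ultimately show ?thesis by (rule finite_imageD)
qed

text \<open>
  The orthogonal complement of all eigenvectors is invariant. If it were not zero, it would contain
  an eigenvector.
\<close>

lemma span_eigenspaces_sym:
  fixes A :: "real^'n^'n"
  assumes A: "A \<in> sym_matrices"
  shows "span (\<Union>l\<in>eigenvalues A. eigenspace A l) = UNIV"
proof -
  let ?E = "\<Union>l\<in>eigenvalues A. eigenspace A l"
  define N where "N = {x. \<forall>y\<in>?E. y \<bullet> x = 0}"
  have sub: "subspace N" by (auto simp: N_def subspace_def inner_add_right)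
  have inv: "A *v x \<in> N" if "x \<in> N" for x
    using that sym_matrices_inner[OF A, of _ x] by (simp add: N_def eigenspace_def)
  have no: "x = 0" if "x \<in> N" "A *v x = l *\<^sub>R x" for x l
  proof (rule ccontr)
    assume "x \<noteq> 0"
    with that(2) have "x \<in> ?E" by (auto simp: eigenvalues_def eigenspace_def)
    with that(1) have "x \<bullet> x = 0" unfolding N_def by blast
    with \<open>x \<noteq> 0\<close> show False by simp
  qed
  have N0: "N = {0}"
  proof (rule ccontr)
    assume "N \<noteq> {0}"
    from A sub this inv obtain x l where "x \<in> N" "x \<noteq> 0" "A *v x = l *\<^sub>R x"
      by (rule sym_eigenvector_in_invariant_subspace)
    with no show False by blast
  qed
  have "x \<in> span ?E" for x
  proof -
    obtain y z where y: "y \<in> span ?E" "\<And>w. w \<in> span ?E \<Longrightarrow> orthogonal z w" "x = y + z"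
      using orthogonal_subspace_decomp_exists[of ?E x] by metis
    have "w \<bullet> z = 0" if "w \<in> ?E" for w
      using y(2)[OF span_base[OF that]] by (simp add: orthogonal_def inner_commute)
    then have "z \<in> N" unfolding N_def by blast
    with y N0 show ?thesis by simp
  qed
  then show ?thesis by auto
qed

lemma dim_Union_eigenspaces:
  assumes A: "A \<in> sym_matrices" and "finite L"
  shows "dim (\<Union>l\<in>L. eigenspace A l) = (\<Sum>l\<in>L. dim (eigenspace A l))"
  using assms(2)
proof induction
  case (insert l L)
  have "dim (eigenspace A l \<union> (\<Union>m\<in>L. eigenspace A m))
      = dim (eigenspace A l) + dim (\<Union>m\<in>L. eigenspace A m)"
    using eigenspaces_orthogonal[OF A] insert(2) by (intro dim_orthogonal_sum) blast
  with insert show ?case by simp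
qed simp

lemma quadratic_bound_eigenspaces:
  assumes A: "A \<in> sym_matrices" and L: "finite L" "\<And>l. l \<in> L \<Longrightarrow> e \<le> s * l"
    and x: "x \<in> span (\<Union>l\<in>L. eigenspace A l)"
  shows "e * (x \<bullet> x) \<le> s * (x \<bullet> (A *v x))"
  using L x
proof (induction L arbitrary: x)
  case (insert l L)
  let ?S = "\<Union>m\<in>L. eigenspace A m"
  have "x \<in> span (eigenspace A l \<union> ?S)" using insert.prems(2) by simp
  then obtain y z where yz: "x = y + z" "y \<in> eigenspace A l" "z \<in> span ?S"
    unfolding span_Un by (auto simp: span_eq_iff[THEN iffD2, OF subspace_eigenspace])
  have "?S \<subseteq> {z. y \<bullet> z = 0}"
    using eigenspaces_orthogonal[OF A yz(2)] insert.hyps(2) by auto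
  then have "span ?S \<subseteq> {z. y \<bullet> z = 0}"
    by (intro span_minimal subspace_hyperplane)
  then have orth: "y \<bullet> z = 0" using yz(3) by blast
  have Ay: "A *v y = l *\<^sub>R y" using yz(2) by (simp add: eigenspace_def)
  then have "y \<bullet> (A *v z) = 0" using sym_matrices_inner[OF A, of y z] orth by simp
  then have q: "x \<bullet> (A *v x) = l * (y \<bullet> y) + z \<bullet> (A *v z)"
    using yz(1) sym_quadratic_add[OF A] Ay by simp
  have n: "x \<bullet> x = y \<bullet> y + z \<bullet> z"
    using yz(1) orth by (simp add: inner_add_left inner_add_right inner_commute[of z y])
  have "e * (z \<bullet> z) \<le> s * (z \<bullet> (A *v z))"
    using insert yz(3) by simp
  moreover have "e * (y \<bullet> y) \<le> (s * l) * (y \<bullet> y)"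
    using insert.prems(1) by (intro mult_right_mono) auto
  ultimately show ?case by (simp add: q n algebra_simps)
qed simp

text \<open>
  The decomposition \<open>\<real>\<^sup>n = U \<oplus> W\<close>.
\<close>

definition complementary :: "(real^'n) set \<Rightarrow> (real^'n) set \<Rightarrow> bool" where
  "complementary U W \<longleftrightarrow>
     subspace U \<and> subspace W \<and> (\<forall>x. \<exists>u\<in>U. x - u \<in> W) \<and> U \<inter> W = {0}"

definition definite_split :: "(real^'n) set \<Rightarrow> (real^'n) set \<Rightarrow> (real^'n^'n) set" where
  "definite_split U W = {A \<in> sym_matrices.
     (\<forall>x\<in>U. x \<noteq> 0 \<longrightarrow> 0 < x \<bullet> (A *v x)) \<and> (\<forall>x\<in>W. x \<noteq> 0 \<longrightarrow> x \<bullet> (A *v x) < 0)}"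

lemma dim_add_le_if_trivial_Int:
  fixes U W :: "(real^'n) set"
  assumes "subspace U" "subspace W" "U \<inter> W \<subseteq> {0}"
  shows "dim U + dim W \<le> CARD('n)"
proof -
  have "dim (U \<inter> W) = 0" using assms(3) by (simp add: dim_eq_0)
  then have "dim U + dim W = dim {x + y |x y. x \<in> U \<and> y \<in> W}"
    using dim_sums_Int[OF assms(1,2)] by linarith
  then show ?thesis by (simp add: dim_subset_UNIV_cart)
qed

lemma complementary_dim:
  fixes U W :: "(real^'n) set"
  assumes "complementary U W"
  shows "dim U + dim W = CARD('n)"
proof -
  have "x \<in> {x + y |x y. x \<in> U \<and> y \<in> W}" for x
  proof -
    obtain u where "u \<in> U" "x - u \<in> W" using assms by (auto simp: complementary_def)
    then have "x = u + (x - u) \<and> u \<in> U \<and> x - u \<in> W" by simp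
    then show ?thesis by blast
  qed
  then have "{x + y |x y. x \<in> U \<and> y \<in> W} = UNIV" by blast
  moreover have "dim (U \<inter> W) = 0" using assms by (simp add: complementary_def)
  ultimately show ?thesis
    using dim_sums_Int[of U W] assms by (simp add: complementary_def)
qed

lemma complementaryI_span:
  assumes "subspace U" "subspace W" "span (U \<union> W) = UNIV" "U \<inter> W \<subseteq> {0}"
  shows "complementary U W"
proof -
  have "\<exists>u\<in>U. x - u \<in> W" for x
  proof -
    have "x \<in> span (U \<union> W)" using assms(3) by simp
    then obtain u w where "x = u + w" "u \<in> U" "w \<in> W"
      using assms(1,2) by (auto simp: span_Un span_eq_iff[THEN iffD2])
    then show ?thesis by (intro bexI[of _ u]) auto
  qed
  then show ?thesis using assms by (auto simp: complementary_def subspace_0)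
qed

text \<open>
  \<open>U\<close> and \<open>W\<close> are spanned by the eigenvectors with positive and with negative eigenvalues. The
  uniform bound \<open>e\<close> makes definiteness on \<open>U\<close> and \<open>W\<close> stable under small perturbations.
\<close>

lemma sym_nonsingular_spectral_split:
  fixes A :: "real^'n^'n"
  assumes A: "A \<in> sym_matrices" and det: "det A \<noteq> 0"
  obtains U W e where "complementary U W" "dim W = matrix_index A" "0 < e"
    "\<And>x. x \<in> U \<Longrightarrow> e * (x \<bullet> x) \<le> x \<bullet> (A *v x)"
    "\<And>x. x \<in> W \<Longrightarrow> x \<bullet> (A *v x) \<le> - e * (x \<bullet> x)"
proof -
  let ?E = "eigenspace A"
  define P where "P = {l \<in> eigenvalues A. 0 < l}"
  define M where "M = {l \<in> eigenvalues A. l < 0}"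
  have fin: "finite P" "finite M" using finite_eigenvalues_sym[OF A] by (auto simp: P_def M_def)
  have "0 \<notin> eigenvalues A"
    using det by (auto simp: eigenvalues_def) (metis invertible_det_nz invertible_def matrix_left_invertible_ker)
  then have eig: "eigenvalues A = P \<union> M"
    by (auto simp: P_def M_def not_less_iff_gr_or_eq)
  define U where "U = span (\<Union>l\<in>P. ?E l)"
  define W where "W = span (\<Union>l\<in>M. ?E l)"
  \<comment> \<open>the element \<open>1\<close> keeps the minimum meaningful if there are no eigenvalues in the set\<close>
  define e where "e = Min (insert 1 (abs ` (P \<union> M)))"
  have e: "0 < e" using fin by (auto simp: e_def P_def M_def)
  have le: "e \<le> \<bar>l\<bar>" if "l \<in> P \<union> M" for l
    unfolding e_def using fin that by (intro Min_le) auto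
  have U: "e * (x \<bullet> x) \<le> x \<bullet> (A *v x)" if "x \<in> U" for x
    using quadratic_bound_eigenspaces[OF A fin(1), of e 1 x] le that by (force simp: U_def P_def)
  have W: "x \<bullet> (A *v x) \<le> - e * (x \<bullet> x)" if "x \<in> W" for x
    using quadratic_bound_eigenspaces[OF A fin(2), of e "-1" x] le that by (force simp: W_def M_def)
  have "x = 0" if "x \<in> U" "x \<in> W" for x
  proof -
    have "e * (x \<bullet> x) \<le> 0" using U[OF that(1)] W[OF that(2)] by simp
    with e have "x \<bullet> x \<le> 0" by (simp add: mult_le_0_iff)
    then show ?thesis using inner_gt_zero_iff[of x] by linarith
  qed
  moreover have "span (U \<union> W) = UNIV"
  proof -
    have "UNIV = span (\<Union>l\<in>eigenvalues A. ?E l)" using span_eigenspaces_sym[OF A] by simp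
    also have "\<dots> \<subseteq> span (U \<union> W)"
      unfolding eig U_def W_def
      using span_superset[of "\<Union>l\<in>P. ?E l"] span_superset[of "\<Union>l\<in>M. ?E l"]
      by (intro span_mono) blast
    finally show ?thesis by auto
  qed
  ultimately have "complementary U W"
    by (intro complementaryI_span) (auto simp: U_def W_def)
  moreover have "dim W = matrix_index A"
    using dim_Union_eigenspaces[OF A fin(2)] by (simp add: W_def matrix_index_def M_def)
  ultimately show ?thesis using that e U W by blast
qed

text \<open>
  If \<open>x = u + w\<close> lies in the kernel, then \<open>A u = - A w\<close>, so the positive number \<open>u \<bullet> A u\<close> equals the
  negative number \<open>w \<bullet> A w\<close> unless \<open>x = 0\<close>.
\<close>

lemma definite_split_nonsingular:
  assumes UW: "complementary U W" and A: "A \<in> definite_split U W"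
  shows "det A \<noteq> 0"
proof
  assume "det A = 0"
  then obtain x where x: "x \<noteq> 0" "A *v x = 0"
    by (metis invertible_det_nz invertible_def matrix_left_right_inverse matrix_left_invertible_ker)
  obtain u where u: "u \<in> U" "x - u \<in> W" using UW by (auto simp: complementary_def)
  define w where "w = x - u"
  have sym: "A \<in> sym_matrices" using A by (simp add: definite_split_def)
  have "A *v u = - (A *v w)" using x(2) by (simp add: w_def matrix_vector_mult_diff_distrib)
  then have "u \<bullet> (A *v u) = w \<bullet> (A *v w)"
    using sym_matrices_inner[OF sym, of u w] by (simp add: inner_commute[of "A *v w" w])
  moreover have "u = 0 \<or> 0 < u \<bullet> (A *v u)" "w = 0 \<or> w \<bullet> (A *v w) < 0"
    using A u by (auto simp: definite_split_def w_def)
  ultimately have "u = 0 \<and> w = 0" by auto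
  with x(1) show False by (simp add: w_def)
qed

text \<open>
  Sylvester's law of inertia: a subspace on which the form is positive meets one on which it is
  negative only in zero. Apply this to \<open>U\<close>, \<open>W\<close> and the spectral subspaces, and compare
  dimensions.
\<close>

lemma definite_split_index:
  fixes A :: "real^'n^'n"
  assumes UW: "complementary U W" and A: "A \<in> definite_split U W"
  shows "matrix_index A = dim W"
proof -
  have sym: "A \<in> sym_matrices" using A by (simp add: definite_split_def)
  obtain U' W' e where *: "complementary U' W'" "dim W' = matrix_index A" "0 < e"
    "\<And>x. x \<in> U' \<Longrightarrow> e * (x \<bullet> x) \<le> x \<bullet> (A *v x)"
    "\<And>x. x \<in> W' \<Longrightarrow> x \<bullet> (A *v x) \<le> - e * (x \<bullet> x)"
    using sym_nonsingular_spectral_split[OF sym definite_split_nonsingular[OF assms]] by metis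
  have nonneg: "0 \<le> e * (x \<bullet> x)" for x :: "real^'n" using *(3) by simp
  have "x = 0" if "x \<in> U'" "x \<in> W" for x
  proof (rule ccontr)
    assume "x \<noteq> 0"
    then have "x \<bullet> (A *v x) < 0" using A that(2) by (simp add: definite_split_def)
    with *(4)[OF that(1)] nonneg[of x] show False by linarith
  qed
  then have "U' \<inter> W \<subseteq> {0}" by blast
  moreover have "x = 0" if "x \<in> U" "x \<in> W'" for x
  proof (rule ccontr)
    assume "x \<noteq> 0"
    then have "0 < x \<bullet> (A *v x)" using A that(1) by (simp add: definite_split_def)
    with *(5)[OF that(2)] nonneg[of x] show False by linarith
  qed
  then have "U \<inter> W' \<subseteq> {0}" by blast
  ultimately have "dim U' + dim W \<le> CARD('n)" "dim U + dim W' \<le> CARD('n)"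
    using UW *(1) by (simp_all add: complementary_def dim_add_le_if_trivial_Int)
  then show ?thesis using complementary_dim[OF UW] complementary_dim[OF *(1)] *(2) by linarith
qed

section \<open>Chains of symmetric matrices of constant index\<close>

lemma outer_in_sym: "t *\<^sub>R outer v v \<in> sym_matrices"
  by (simp add: sym_matrices_def transpose_def outer_def vec_eq_iff mult.commute)

lemma sym_matrices_add_scaleR:
  "A \<in> sym_matrices \<Longrightarrow> B \<in> sym_matrices \<Longrightarrow> A + t *\<^sub>R B \<in> sym_matrices"
  by (simp add: sym_matrices_def transpose_def vec_eq_iff)

lemma sym_matrices_sum:
  "(\<And>i. i \<in> I \<Longrightarrow> f i \<in> sym_matrices) \<Longrightarrow> sum f I \<in> sym_matrices"
proof (induction I rule: infinite_finite_induct)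
  case (insert i I)
  then show ?case using sym_matrices_add_scaleR[of "f i" "sum f I" 1] by simp
qed (simp_all add: sym_matrices_def transpose_def vec_eq_iff)

lemma sum_matrix_vector_mult: "sum f I *v x = (\<Sum>i\<in>I. f i *v x)"
  by (induction I rule: infinite_finite_induct) (simp_all add: matrix_vector_mult_add_rdistrib)

lemma inner_sum_outer:
  "x \<bullet> ((\<Sum>i\<in>I. c i *\<^sub>R outer (v i) (v i)) *v x) = (\<Sum>i\<in>I. c i * (v i \<bullet> x)\<^sup>2)"
  by (simp add: sum_matrix_vector_mult inner_sum_right scaleR_matrix_vector_assoc[symmetric]
      outer_mult_vec inner_commute[of x] power2_eq_square mult_ac)

lemma inner_add_sum_outer:
  "x \<bullet> ((A + (\<Sum>i\<in>I. c i *\<^sub>R outer (v i) (v i))) *v x)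
     = x \<bullet> (A *v x) + (\<Sum>i\<in>I. c i * (v i \<bullet> x)\<^sup>2)"
  by (simp add: matrix_vector_mult_add_rdistrib inner_add_right inner_sum_outer)

text \<open>
  Polarization: \<open>e\<^sub>p e\<^sub>q\<^sup>T + e\<^sub>q e\<^sub>p\<^sup>T\<close> is half the difference of the squares of \<open>e\<^sub>p + e\<^sub>q\<close> and
  \<open>e\<^sub>p - e\<^sub>q\<close>.
\<close>

lemma sym_matrix_sum_outer:
  fixes A :: "real^'n^'n"
  assumes "A \<in> sym_matrices"
  obtains c :: "'n \<times> 'n \<times> bool \<Rightarrow> real" and v
    where "A = (\<Sum>i\<in>UNIV. c i *\<^sub>R outer (v i) (v i))"
proof -
  let ?c = "\<lambda>(p, q, b). (if b then 1/4 else - 1/4) * A $ p $ q"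
  let ?v = "\<lambda>(p, q, b). axis p 1 + (if b then 1 else - 1 :: real) *\<^sub>R axis q (1::real) :: real^'n"
  have AT: "A $ q $ p = A $ p $ q" for p q
    using assms by (simp add: sym_matrices_def transpose_def vec_eq_iff)
  have "(\<Sum>i\<in>UNIV. ?c i *\<^sub>R outer (?v i) (?v i)) = A"
  proof -
    have "(\<Sum>i\<in>UNIV. ?c i *\<^sub>R outer (?v i) (?v i))
        = (\<Sum>p\<in>UNIV. \<Sum>q\<in>UNIV. \<Sum>b\<in>UNIV. ?c (p, q, b) *\<^sub>R outer (?v (p, q, b)) (?v (p, q, b)))"
      by (simp add: UNIV_Times_UNIV[symmetric] sum.cartesian_product case_prod_unfold del: UNIV_Times_UNIV)
    also have "\<dots> = (\<Sum>p\<in>UNIV. \<Sum>q\<in>UNIV. (A $ p $ q / 2) *\<^sub>R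
        (outer (axis p 1) (axis q 1) + outer (axis q 1) (axis p 1)))"
      by (intro sum.cong refl)
         (simp add: UNIV_bool outer_simps vec_eq_iff outer_def algebra_simps)
    also have "\<dots> = A"
    proof -
      have ind: "(\<Sum>p\<in>UNIV. \<Sum>q\<in>UNIV. if p = r then if q = s then z else 0 else 0) = z"
        for r s :: 'n and z :: real
      proof -
        have "(\<Sum>q\<in>UNIV. if p = r then if q = s then z else 0 else 0) = (if p = r then z else 0)" for p
          by simp
        then show ?thesis by simp
      qed
      have "(\<Sum>p\<in>UNIV. \<Sum>q\<in>UNIV. (A $ p $ q / 2) *\<^sub>R
          (outer (axis p 1) (axis q 1) + outer (axis q 1) (axis p 1))) $ r $ s = A $ r $ s" for r s
      proof -
        have "(\<Sum>p\<in>UNIV. \<Sum>q\<in>UNIV. (A $ p $ q / 2) *\<^sub>R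
          (outer (axis p 1) (axis q 1) + outer (axis q 1) (axis p 1))) $ r $ s
          = (\<Sum>p\<in>UNIV. \<Sum>q\<in>UNIV. (if p = r then if q = s then A $ p $ q / 2 else 0 else 0)
             + (if p = s then if q = r then A $ p $ q / 2 else 0 else 0))"
          by (simp add: sum_component) (intro sum.cong refl, auto simp: outer_def axis_def)
        also have "\<dots> = A $ r $ s / 2 + A $ s $ r / 2"
          by (simp add: sum.distrib ind cong: if_cong)
        finally show ?thesis using AT[of s r] by simp
      qed
      then show ?thesis by (simp add: vec_eq_iff)
    qed
    finally show ?thesis .
  qed
  then show ?thesis using that[of ?c ?v] by simp
qed

text \<open>
  The whole segment, and not just its end points, has to consist of non-singular matrices of index
  \<open>k\<close>, so that the determinant keeps its sign along the step.
\<close>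

definition index_step :: "nat \<Rightarrow> real^'n^'n \<Rightarrow> real^'n^'n \<Rightarrow> bool" where
  "index_step k A B \<longleftrightarrow>
     (\<exists>c v. B = A + c *\<^sub>R outer v v) \<and>
     (\<forall>t\<in>{0..1}. A + t *\<^sub>R (B - A) \<in> sym_matrices \<and>
        det (A + t *\<^sub>R (B - A)) \<noteq> 0 \<and> matrix_index (A + t *\<^sub>R (B - A)) = k)"

lemma index_step_sym: 
  assumes "index_step k A B"
  shows "index_step k B A"
proof -
  obtain c v where "B = A + c *\<^sub>R outer v v" using assms by (auto simp: index_step_def)
  then have "A = B + (- c) *\<^sub>R outer v v" by simp
  then have "\<exists>c v. A = B + c *\<^sub>R outer v v" by blast
  moreover have "B + t *\<^sub>R (A - B) = A + (1 - t) *\<^sub>R (B - A)" for t by (simp add: algebra_simps)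
  ultimately show ?thesis using assms unfolding index_step_def by simp
qed

lemma index_chain_sym: "(index_step k)\<^sup>*\<^sup>* A B \<Longrightarrow> (index_step k)\<^sup>*\<^sup>* B A"
  by (induction rule: rtranclp_induct)
     (auto intro: index_step_sym converse_rtranclp_into_rtranclp)

text \<open>
  The rank-one terms are added one at a time; convexity of \<open>C\<close> keeps the segments between
  consecutive partial sums in \<open>C\<close>. The hypothesis on all subsets avoids fixing an order.
\<close>

lemma index_chain_sum:
  assumes C: "convex C" "C \<subseteq> {A \<in> sym_matrices. det A \<noteq> 0 \<and> matrix_index A = k}"
    and "finite I" and part: "\<And>J. J \<subseteq> I \<Longrightarrow> A + (\<Sum>i\<in>J. c i *\<^sub>R outer (v i) (v i)) \<in> C"
  shows "(index_step k)\<^sup>*\<^sup>* A (A + (\<Sum>i\<in>I. c i *\<^sub>R outer (v i) (v i)))"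
  using assms(3) part
proof induction
  case (insert i I)
  have seg: "X + t *\<^sub>R (Y - X) = (1 - t) *\<^sub>R X + t *\<^sub>R Y" for X Y :: "real^'a^'a" and t
    by (simp add: algebra_simps)
  let ?S = "\<lambda>J. A + (\<Sum>i\<in>J. c i *\<^sub>R outer (v i) (v i))"
  have in_C: "?S I \<in> C" "?S (insert i I) \<in> C" using insert.prems by blast+
  have "index_step k (?S I) (?S (insert i I))"
    unfolding index_step_def
  proof (intro conjI ballI)
    show "\<exists>d w. ?S (insert i I) = ?S I + d *\<^sub>R outer w w"
      using insert.hyps by (intro exI[of _ "c i"] exI[of _ "v i"]) simp
    fix t :: real assume t: "t \<in> {0..1}"
    have "?S I + t *\<^sub>R (?S (insert i I) - ?S I) = (1 - t) *\<^sub>R ?S I + t *\<^sub>R ?S (insert i I)"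
      by (rule seg)
    also have "\<dots> \<in> C" using C(1) in_C t by (intro convexD_alt) auto
    finally have "?S I + t *\<^sub>R (?S (insert i I) - ?S I) \<in> C" .
    with C(2) show "?S I + t *\<^sub>R (?S (insert i I) - ?S I) \<in> sym_matrices"
      "det (?S I + t *\<^sub>R (?S (insert i I) - ?S I)) \<noteq> 0"
      "matrix_index (?S I + t *\<^sub>R (?S (insert i I) - ?S I)) = k" by blast+
  qed
  moreover have "(index_step k)\<^sup>*\<^sup>* A (?S I)" using insert by blast
  ultimately show ?case by (rule rtranclp.rtrancl_into_rtrancl[rotated])
qed simp

lemma convex_definite_split: "convex (definite_split U W)"
proof (rule convexI)
  fix A B :: "real^'a^'a" and s t :: real
  assume A: "A \<in> definite_split U W" and B: "B \<in> definite_split U W"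
    and st: "0 \<le> s" "0 \<le> t" "s + t = 1"
  have q: "x \<bullet> ((s *\<^sub>R A + t *\<^sub>R B) *v x) = s * (x \<bullet> (A *v x)) + t * (x \<bullet> (B *v x))" for x
    by (simp add: matrix_vector_mult_add_rdistrib inner_add_right scaleR_matrix_vector_assoc[symmetric])
  have "s *\<^sub>R A + t *\<^sub>R B \<in> sym_matrices"
    using A B by (simp add: definite_split_def sym_matrices_def transpose_def vec_eq_iff)
  moreover have "0 < s * a + t * b" if "0 < a" "0 < b" for a b :: real
    using st that by (cases "s = 0") (auto intro: add_pos_nonneg)
  moreover have "s * a + t * b < 0" if "a < 0" "b < 0" for a b :: real
    using calculation(2)[of "- a" "- b"] that by simp
  ultimately show "s *\<^sub>R A + t *\<^sub>R B \<in> definite_split U W"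
    using A B by (simp add: definite_split_def q)
qed

lemma complementary_projection:
  fixes U W :: "(real^'n) set"
  assumes "complementary U W"
  obtains P where "\<And>x. P *v x \<in> U"
    "\<And>x. x \<in> U \<Longrightarrow> P *v x = x" "\<And>x. x \<in> W \<Longrightarrow> P *v x = 0"
proof -
  have UW: "subspace U" "subspace W" "U \<inter> W = {0}" using assms by (auto simp: complementary_def)
  obtain f where f: "\<And>x. f x \<in> U \<and> x - f x \<in> W"
    using assms unfolding complementary_def by metis
  have uniq: "f x = u" if "u \<in> U" "x - u \<in> W" for x u
  proof -
    have "f x - u \<in> U" using UW f that by (simp add: subspace_diff)
    moreover have "f x - u = (x - u) - (x - f x)" by simp
    then have "f x - u \<in> W" using subspace_diff[OF UW(2) that(2) f[of x, THEN conjunct2]] by simp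
    ultimately have "f x - u \<in> U \<inter> W" by blast
    then show ?thesis unfolding UW(3) by simp
  qed
  have "linear f"
  proof (rule linearI)
    fix x y
    have "x + y - (f x + f y) = (x - f x) + (y - f y)" by simp
    then have "x + y - (f x + f y) \<in> W"
      using subspace_add[OF UW(2) f[of x, THEN conjunct2] f[of y, THEN conjunct2]] by (simp only:)
    then show "f (x + y) = f x + f y" using UW f by (intro uniq) (auto intro: subspace_add)
  next
    fix c x
    have "c *\<^sub>R x - c *\<^sub>R f x = c *\<^sub>R (x - f x)" by (simp add: scaleR_diff_right)
    then have "c *\<^sub>R x - c *\<^sub>R f x \<in> W"
      using subspace_mul[OF UW(2) f[of x, THEN conjunct2]] by (simp only:)
    then show "f (c *\<^sub>R x) = c *\<^sub>R f x" using UW f by (intro uniq) (auto intro: subspace_mul)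
  qed
  then have "matrix f *v x = f x" for x by (simp add: matrix_works)
  moreover have "f x = x" if "x \<in> U" for x using that UW by (intro uniq) (auto simp: subspace_0)
  moreover have "f x = 0" if "x \<in> W" for x using that UW by (intro uniq) (auto simp: subspace_0)
  ultimately show ?thesis using that[of "matrix f"] f by simp
qed

text \<open>
  The linear forms given by the coordinates of \<open>P x\<close> and of \<open>x - P x\<close>. If \<open>P\<close> is the projection onto
  \<open>U\<close> along \<open>W\<close>, the former vanish on \<open>W\<close> and the latter on \<open>U\<close>.
\<close>

definition proj_row :: "real^'n^'n \<Rightarrow> 'n \<times> bool \<Rightarrow> real^'n" where
  "proj_row P i = row (fst i) (if snd i then P else mat 1 - P)"

text \<open>
  The matrix of the quadratic form \<open>a |P x|\<^sup>2 + b |x - P x|\<^sup>2\<close>.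
\<close>

definition proj_form :: "real^'n^'n \<Rightarrow> real \<Rightarrow> real \<Rightarrow> real^'n^'n" where
  "proj_form P a b =
     (\<Sum>i\<in>UNIV. (if snd i then a else b) *\<^sub>R outer (proj_row P i) (proj_row P i))"

lemma proj_row_inner:
  "proj_row P (p, s) \<bullet> x = (if s then P *v x else x - P *v x) $ p"
proof -
  have "row p Q \<bullet> x = (Q *v x) $ p" for Q :: "real^'a^'a"
    by (simp add: row_def matrix_mult_dot)
  then show ?thesis by (simp add: proj_row_def matrix_vector_mult_diff_rdistrib)
qed

lemma proj_form_sym: "proj_form P a b \<in> sym_matrices"
  unfolding proj_form_def by (intro sym_matrices_sum outer_in_sym)

lemma inner_proj_form:
  "x \<bullet> (proj_form P a b *v x) =
     a * ((P *v x) \<bullet> (P *v x)) + b * ((x - P *v x) \<bullet> (x - P *v x))"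
proof -
  have "x \<bullet> (proj_form P a b *v x)
      = (\<Sum>i\<in>UNIV \<times> UNIV. (if snd i then a else b) * (proj_row P i \<bullet> x)\<^sup>2)"
    unfolding proj_form_def inner_sum_outer by simp
  also have "\<dots> = (\<Sum>p\<in>UNIV. \<Sum>s\<in>UNIV. (if s then a else b) * (proj_row P (p, s) \<bullet> x)\<^sup>2)"
    by (simp add: sum.cartesian_product case_prod_unfold)
  also have "\<dots> = (\<Sum>p\<in>UNIV. a * ((P *v x) $ p)\<^sup>2) + (\<Sum>p\<in>UNIV. b * ((x - P *v x) $ p)\<^sup>2)"
    by (simp add: UNIV_bool proj_row_inner sum.distrib add.commute)
  also have "\<dots> = a * ((P *v x) \<bullet> (P *v x)) + b * ((x - P *v x) \<bullet> (x - P *v x))"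
    by (simp add: inner_vec_def sum_distrib_left power2_eq_square)
  finally show ?thesis .
qed

lemma definite_split_subset:
  assumes "complementary U W"
  shows "definite_split U W \<subseteq>
    {A \<in> sym_matrices. det A \<noteq> 0 \<and> matrix_index A = dim W}"
  using definite_split_nonsingular[OF assms] definite_split_index[OF assms]
  by (auto simp: definite_split_def)

text \<open>
  Each term that is added vanishes on one of \<open>U\<close>, \<open>W\<close> and strengthens definiteness on the other.
\<close>

lemma index_chain_add_proj_form:
  assumes UW: "complementary U W" and A: "A \<in> definite_split U W"
    and P: "\<And>x. x \<in> U \<Longrightarrow> P *v x = x" "\<And>x. x \<in> W \<Longrightarrow> P *v x = 0" and T: "0 \<le> T"
  shows "(index_step (dim W))\<^sup>*\<^sup>* A (A + proj_form P T (- T))"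
  unfolding proj_form_def
proof (rule index_chain_sum[OF convex_definite_split definite_split_subset[OF UW]])
  fix J :: "('a \<times> bool) set"
  let ?c = "\<lambda>i::'a \<times> bool. if snd i then T else - T"
  let ?S = "\<Sum>i\<in>J. ?c i *\<^sub>R outer (proj_row P i) (proj_row P i)"
  have "A + 1 *\<^sub>R ?S \<in> sym_matrices"
    using A by (intro sym_matrices_add_scaleR sym_matrices_sum outer_in_sym) (simp add: definite_split_def)
  moreover have "0 < x \<bullet> ((A + ?S) *v x)" if "x \<in> U" "x \<noteq> 0" for x
  proof -
    have "0 \<le> ?c i * (proj_row P i \<bullet> x)\<^sup>2" for i
      using P(1)[OF that(1)] T by (cases i) (auto simp: proj_row_inner)
    then have "0 \<le> (\<Sum>i\<in>J. ?c i * (proj_row P i \<bullet> x)\<^sup>2)" by (intro sum_nonneg)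
    moreover have "0 < x \<bullet> (A *v x)" using A that by (simp add: definite_split_def)
    ultimately show ?thesis by (simp only: inner_add_sum_outer)
  qed
  moreover have "x \<bullet> ((A + ?S) *v x) < 0" if "x \<in> W" "x \<noteq> 0" for x
  proof -
    have "?c i * (proj_row P i \<bullet> x)\<^sup>2 \<le> 0" for i
      using P(2)[OF that(1)] T by (cases i) (auto simp: proj_row_inner)
    then have "(\<Sum>i\<in>J. ?c i * (proj_row P i \<bullet> x)\<^sup>2) \<le> 0" by (intro sum_nonpos)
    moreover have "x \<bullet> (A *v x) < 0" using A that by (simp add: definite_split_def)
    ultimately show ?thesis by (simp only: inner_add_sum_outer)
  qed
  ultimately show "A + ?S \<in> definite_split U W" by (simp add: definite_split_def)
qed simp

text \<open>
  Write \<open>B - A\<close> as a sum of rank-one terms and let \<open>K\<close> bound the form of every partial sum. After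
  adding \<open>proj_form P K (- K)\<close> to \<open>A\<close>, these terms can be added one by one without leaving
  \<open>definite_split U W\<close>, and the outcome is \<open>B\<close> plus the same matrix.
\<close>

lemma index_chain_definite_split:
  fixes A B :: "real^'n^'n"
  assumes UW: "complementary U W" and A: "A \<in> definite_split U W" and B: "B \<in> definite_split U W"
  shows "(index_step (dim W))\<^sup>*\<^sup>* A B"
proof -
  obtain P where P: "\<And>x. x \<in> U \<Longrightarrow> P *v x = x" "\<And>x. x \<in> W \<Longrightarrow> P *v x = 0"
    using complementary_projection[OF UW] by metis
  have sym: "A \<in> sym_matrices" "B \<in> sym_matrices" using A B by (auto simp: definite_split_def)
  have "B + (-1) *\<^sub>R A \<in> sym_matrices" using sym by (intro sym_matrices_add_scaleR)
  then obtain c :: "'n \<times> 'n \<times> bool \<Rightarrow> real" and v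
    where D: "B + (-1) *\<^sub>R A = (\<Sum>i\<in>UNIV. c i *\<^sub>R outer (v i) (v i))"
    by (rule sym_matrix_sum_outer)
  define K where "K = (\<Sum>i\<in>UNIV. \<bar>c i\<bar> * (v i \<bullet> v i))"
  have K: "0 \<le> K" unfolding K_def by (intro sum_nonneg) simp
  have bound: "\<bar>\<Sum>i\<in>J. c i * (v i \<bullet> x)\<^sup>2\<bar> \<le> K * (x \<bullet> x)" for J x
  proof -
    have "\<bar>\<Sum>i\<in>J. c i * (v i \<bullet> x)\<^sup>2\<bar> \<le> (\<Sum>i\<in>J. \<bar>c i * (v i \<bullet> x)\<^sup>2\<bar>)" by (rule sum_abs)
    also have "\<dots> \<le> (\<Sum>i\<in>UNIV. \<bar>c i * (v i \<bullet> x)\<^sup>2\<bar>)" by (intro sum_mono2) auto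
    also have "\<dots> \<le> (\<Sum>i\<in>UNIV. (\<bar>c i\<bar> * (v i \<bullet> v i)) * (x \<bullet> x))"
      by (intro sum_mono) (simp add: abs_mult mult.assoc mult_left_mono Cauchy_Schwarz_ineq)
    finally show ?thesis by (simp add: K_def sum_distrib_right)
  qed
  let ?J = "proj_form P K (- K)"
  have JU: "x \<bullet> (?J *v x) = K * (x \<bullet> x)" if "x \<in> U" for x
    using P(1)[OF that] by (simp add: inner_proj_form)
  have JW: "x \<bullet> (?J *v x) = - K * (x \<bullet> x)" if "x \<in> W" for x
    using P(2)[OF that] by (simp add: inner_proj_form)
  have "(index_step (dim W))\<^sup>*\<^sup>* (A + ?J)
      (A + ?J + (\<Sum>i\<in>UNIV. c i *\<^sub>R outer (v i) (v i)))"
  proof (rule index_chain_sum[OF convex_definite_split definite_split_subset[OF UW]])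
    fix J :: "('n \<times> 'n \<times> bool) set"
    let ?S = "\<Sum>i\<in>J. c i *\<^sub>R outer (v i) (v i)"
    have "A + 1 *\<^sub>R ?J + 1 *\<^sub>R ?S \<in> sym_matrices"
      by (intro sym_matrices_add_scaleR sym_matrices_sum outer_in_sym proj_form_sym sym)
    moreover have q: "x \<bullet> ((A + ?J + ?S) *v x)
        = x \<bullet> (A *v x) + x \<bullet> (?J *v x) + (\<Sum>i\<in>J. c i * (v i \<bullet> x)\<^sup>2)" for x
      by (simp add: inner_add_sum_outer) (simp add: matrix_vector_mult_add_rdistrib inner_add_right)
    moreover have "0 < x \<bullet> ((A + ?J + ?S) *v x)" if "x \<in> U" "x \<noteq> 0" for x
    proof -
      have "0 < x \<bullet> (A *v x)" using A that by (simp add: definite_split_def)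
      then show ?thesis unfolding q JU[OF that(1)] using bound[where J=J and x=x] by linarith
    qed
    moreover have "x \<bullet> ((A + ?J + ?S) *v x) < 0" if "x \<in> W" "x \<noteq> 0" for x
    proof -
      have "x \<bullet> (A *v x) < 0" using A that by (simp add: definite_split_def)
      then show ?thesis unfolding q JW[OF that(1)] using bound[where J=J and x=x] by linarith
    qed
    ultimately show "A + ?J + ?S \<in> definite_split U W" by (simp add: definite_split_def)
  qed simp
  also have "A + ?J + (\<Sum>i\<in>UNIV. c i *\<^sub>R outer (v i) (v i)) = B + ?J"
    unfolding D[symmetric] by simp
  finally have "(index_step (dim W))\<^sup>*\<^sup>* (A + ?J) (B + ?J)" .
  moreover have "(index_step (dim W))\<^sup>*\<^sup>* A (A + ?J)" "(index_step (dim W))\<^sup>*\<^sup>* B (B + ?J)"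
    using index_chain_add_proj_form[OF UW _ P K] A B by blast+
  ultimately show ?thesis by (meson index_chain_sym rtranclp_trans)
qed

text \<open>
  With \<open>P\<close> the projection onto \<open>U\<close> along \<open>W\<close>, the form \<open>a |P x|\<^sup>2 - |x - P x|\<^sup>2\<close> is positive on \<open>U\<close>
  and negative on \<open>W\<close>. The map \<open>x - P x\<close> is injective on \<open>W'\<close>, hence bounded below there, so for
  small \<open>a\<close> the form is negative on \<open>W'\<close> as well.
\<close>

lemma definite_splits_meet:
  fixes U W W' :: "(real^'n) set"
  assumes UW: "complementary U W" and UW': "complementary U W'"
  shows "definite_split U W \<inter> definite_split U W' \<noteq> {}"
proof -
  obtain P where P: "\<And>x. P *v x \<in> U" "\<And>x. x \<in> U \<Longrightarrow> P *v x = x" "\<And>x. x \<in> W \<Longrightarrow> P *v x = 0"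
    using complementary_projection[OF UW] by metis
  have W': "subspace W'" "U \<inter> W' = {0}" using UW' by (auto simp: complementary_def)
  have lin: "bounded_linear (\<lambda>x. x - P *v x)"
    by (intro bounded_linear_sub bounded_linear_ident matrix_vector_mul_bounded_linear)
  have "\<forall>x\<in>W'. x - P *v x = 0 \<longrightarrow> x = 0"
  proof (intro ballI impI)
    fix x assume "x \<in> W'" "x - P *v x = 0"
    then have "P *v x = x" by (metis right_minus_eq)
    with P(1)[of x] have "x \<in> U" by (simp only:)
    with \<open>x \<in> W'\<close> have "x \<in> U \<inter> W'" by blast
    then show "x = 0" unfolding W'(2) by simp
  qed
  from injective_imp_isometric[OF closed_subspace[OF W'(1)] W'(1) lin this]
  obtain e where e: "0 < e" "\<And>x. x \<in> W' \<Longrightarrow> e * norm x \<le> norm (x - P *v x)"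
    by blast
  obtain K where K: "0 < K" "\<And>x. norm (P *v x) \<le> norm x * K"
    using bounded_linear.pos_bounded[OF matrix_vector_mul_bounded_linear[of P]] by blast
  \<comment> \<open>chosen so that \<open>a |P x|\<^sup>2 \<le> e\<^sup>2 |x|\<^sup>2 / 4\<close>, a quarter of the lower bound for \<open>|x - P x|\<^sup>2\<close> on \<open>W'\<close>\<close>
  define a where "a = (e / (2 * K))\<^sup>2"
  have a: "0 < a" using e(1) K(1) by (simp add: a_def)
  let ?A = "proj_form P a (-1)"
  have "x \<bullet> (?A *v x) > 0" if "x \<in> U" "x \<noteq> 0" for x
    using P(2)[OF that(1)] that a by (simp add: inner_proj_form)
  moreover have "x \<bullet> (?A *v x) < 0" if "x \<in> W" "x \<noteq> 0" for x
    using P(3)[OF that(1)] that by (simp add: inner_proj_form)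
  moreover have "x \<bullet> (?A *v x) < 0" if "x \<in> W'" "x \<noteq> 0" for x
  proof -
    have "a * (norm (P *v x))\<^sup>2 \<le> a * (norm x * K)\<^sup>2"
      using a K(2)[of x] by (intro mult_left_mono power_mono) auto
    also have "\<dots> = (e * norm x)\<^sup>2 / 4"
      using K(1) by (simp add: a_def field_simps)
    also have "\<dots> < (e * norm x)\<^sup>2" using e(1) that by simp
    also have "\<dots> \<le> (norm (x - P *v x))\<^sup>2"
      using e that(1) by (intro power_mono) auto
    finally show ?thesis by (simp add: inner_proj_form power2_norm_eq_inner)
  qed
  ultimately have "?A \<in> definite_split U W \<inter> definite_split U W'"
    by (simp add: definite_split_def proj_form_sym)
  then show ?thesis by blast
qed

lemma complementary_commute: "complementary U W \<Longrightarrow> complementary W U"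
  unfolding complementary_def
proof (elim conjE, intro conjI allI)
  fix x assume "subspace U" "\<forall>x. \<exists>u\<in>U. x - u \<in> W"
  then obtain u where "u \<in> U" "x - u \<in> W" by blast
  then show "\<exists>w\<in>W. x - w \<in> U" by (intro bexI[of _ "x - u"]) auto
qed auto

lemma uminus_definite_split: "A \<in> definite_split U W \<Longrightarrow> - A \<in> definite_split W U"
proof -
  assume A: "A \<in> definite_split U W"
  have q: "x \<bullet> (- A *v x) = - (x \<bullet> (A *v x))" for x
    using matrix_vector_mult_diff_rdistrib[of 0 A x] by simp
  have "- A \<in> sym_matrices"
    using A by (simp add: definite_split_def sym_matrices_def transpose_def vec_eq_iff)
  then show ?thesis using A by (simp add: definite_split_def q)
qed

text \<open>
  Induction on the codimension: two proper subspaces do not cover the space, so some vector \<open>v\<close> can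
  be added to both, and also to the complement of the enlarged subspaces. Counting the vectors
  chosen shows that they span no more than a complement.
\<close>

lemma common_complement:
  fixes W W' :: "(real^'n) set"
  assumes "subspace W" "subspace W'" "dim W = dim W'"
  obtains U where "complementary U W" "complementary U W'"
proof -
  have "\<exists>B. finite B \<and> card B + dim W \<le> CARD('n) \<and> span (B \<union> W) = UNIV \<and> span (B \<union> W') = UNIV"
    using assms
  proof (induction "CARD('n) - dim W" arbitrary: W W')
    case 0
    have "dim W \<le> CARD('n)" by (rule dim_subset_UNIV_cart)
    with 0 have d: "dim W = CARD('n)" "dim W' = CARD('n)" by auto
    then have "span W = UNIV" "span W' = UNIV" by (simp_all add: dim_eq_full[symmetric])
    then show ?case using d by (intro exI[of _ "{}"]) auto
  next
    case (Suc m)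
    then have lt: "dim W < CARD('n)" "dim W' < CARD('n)" by auto
    then have "W \<noteq> UNIV" "W' \<noteq> UNIV" by auto
    then obtain a b where ab: "a \<notin> W" "b \<notin> W'" by blast
    have "\<exists>v. v \<notin> W \<and> v \<notin> W'"
    proof (cases "a \<in> W' \<and> b \<in> W")
      case True
      have "a + b \<notin> W" "a + b \<notin> W'"
        using True ab Suc.prems subspace_diff[of W "a + b" b] subspace_diff[of W' "a + b" a] by auto
      then show ?thesis by blast
    qed (use ab in blast)
    then obtain v where v: "v \<notin> W" "v \<notin> W'" by blast
    have "span W = W" "span W' = W'" using Suc.prems(1,2) by (simp_all only: span_eq_iff)
    then have "v \<notin> span W" "v \<notin> span W'" using v by (simp_all only:) simp_all
    then have d: "dim (insert v W) = Suc (dim W)" "dim (insert v W') = Suc (dim W')"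
      by (simp_all add: dim_insert)
    have "\<exists>B. finite B \<and> card B + dim (span (insert v W)) \<le> CARD('n) \<and>
        span (B \<union> span (insert v W)) = UNIV \<and> span (B \<union> span (insert v W')) = UNIV"
    proof (rule Suc.hyps(1))
      show "m = CARD('n) - dim (span (insert v W))"
        using Suc.hyps(2) d by (simp only: dim_span)
      show "dim (span (insert v W)) = dim (span (insert v W'))"
        using Suc.prems(3) d by (simp only: dim_span)
    qed (rule subspace_span)+
    then obtain B where B: "finite B" "card B + Suc (dim W) \<le> CARD('n)"
      "span (B \<union> span (insert v W)) = UNIV" "span (B \<union> span (insert v W')) = UNIV"
      unfolding dim_span d by blast
    have grow: "span (insert v B \<union> S) = UNIV" if "span (B \<union> span (insert v S)) = UNIV" for S
    proof -
      have "span (insert v S) \<subseteq> span (insert v B \<union> S)" by (intro span_mono) blast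
      then have "B \<union> span (insert v S) \<subseteq> span (insert v B \<union> S)"
        using span_superset[of "insert v B \<union> S"] by blast
      then have "span (B \<union> span (insert v S)) \<subseteq> span (insert v B \<union> S)"
        by (intro span_minimal) auto
      with that show ?thesis by blast
    qed
    have "card (insert v B) \<le> Suc (card B)" by (rule card_insert_le_m1) auto
    then have "finite (insert v B) \<and> card (insert v B) + dim W \<le> CARD('n) \<and>
        span (insert v B \<union> W) = UNIV \<and> span (insert v B \<union> W') = UNIV"
      using B grow by auto
    then show ?case by blast
  qed
  then obtain B where B: "finite B" "card B + dim W \<le> CARD('n)"
    "span (B \<union> W) = UNIV" "span (B \<union> W') = UNIV" by blast
  have "complementary (span B) S" if S: "subspace S" "dim S = dim W" "span (B \<union> S) = UNIV" for S
  proof (rule complementaryI_span)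
    have "UNIV \<subseteq> span (span B \<union> S)"
      unfolding S(3)[symmetric] using span_superset[of B] by (intro span_mono) blast
    then show sp: "span (span B \<union> S) = UNIV" by blast
    have "x \<in> {x + y |x y. x \<in> span B \<and> y \<in> S}" for x
      using sp S(1) by (auto simp: span_Un span_eq_iff[THEN iffD2])
    then have "{x + y |x y. x \<in> span B \<and> y \<in> S} = UNIV" by blast
    then have "CARD('n) + dim (span B \<inter> S) = dim (span B) + dim S"
      using dim_sums_Int[OF subspace_span S(1), of B] by simp
    moreover have "dim (span B) \<le> card B" using B(1) by (simp add: dim_le_card')
    ultimately have "dim (span B \<inter> S) = 0" using B(2) S(2) by linarith
    then show "span B \<inter> S \<subseteq> {0}" by (simp add: dim_eq_0)
  qed (use S in auto)
  from this[of W] this[of W'] show ?thesis using assms B by (intro that[of "span B"]) auto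
qed

text \<open>
  The splittings are changed along
  \<open>(U, W)\<close>, \<open>(V, W)\<close>, \<open>(V, W')\<close>, \<open>(U', W')\<close> with \<open>V\<close> a common complement of \<open>W\<close> and \<open>W'\<close>; consecutive
  ones share a matrix, which serves as an intermediate point of the chain.
\<close>

lemma index_chain_connected:
  fixes A B :: "real^'n^'n"
  assumes A: "A \<in> sym_matrices" "det A \<noteq> 0" "matrix_index A = k"
    and B: "B \<in> sym_matrices" "det B \<noteq> 0" "matrix_index B = k"
  shows "(index_step k)\<^sup>*\<^sup>* A B"
proof -
  have split: "\<exists>U W. complementary U W \<and> dim W = k \<and> C \<in> definite_split U W"
    if C: "C \<in> sym_matrices" "det C \<noteq> 0" "matrix_index C = k" for C :: "real^'n^'n"
  proof -
    obtain U W e where *: "complementary U W" "dim W = matrix_index C" "0 < e"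
      "\<And>x. x \<in> U \<Longrightarrow> e * (x \<bullet> x) \<le> x \<bullet> (C *v x)"
      "\<And>x. x \<in> W \<Longrightarrow> x \<bullet> (C *v x) \<le> - e * (x \<bullet> x)"
      using sym_nonsingular_spectral_split[OF C(1,2)] by metis
    have "0 < e * (x \<bullet> x)" if "x \<noteq> 0" for x :: "real^'n" using *(3) that by simp
    then have "C \<in> definite_split U W"
      using *(4,5) C(1) unfolding definite_split_def by fastforce
    with * C(3) show ?thesis by blast
  qed
  obtain U W where UW: "complementary U W" "dim W = k" "A \<in> definite_split U W"
    using split[OF A] by blast
  obtain U' W' where UW': "complementary U' W'" "dim W' = k" "B \<in> definite_split U' W'"
    using split[OF B] by blast
  have "subspace W" "subspace W'" using UW UW' by (auto simp: complementary_def)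
  then obtain V where V: "complementary V W" "complementary V W'"
    using common_complement[of W W'] UW(2) UW'(2) by auto
  \<comment> \<open>exchanging the positive and the negative subspace amounts to a change of sign\<close>
  have change: "\<exists>X. X \<in> definite_split S T \<and> X \<in> definite_split S' T"
    if "complementary S T" "complementary S' T" for S S' T :: "(real^'n) set"
    using definite_splits_meet[OF that[THEN complementary_commute]] uminus_definite_split by blast
  obtain X where X: "X \<in> definite_split U W" "X \<in> definite_split V W"
    using change[OF UW(1) V(1)] by blast
  obtain Y where Y: "Y \<in> definite_split V W" "Y \<in> definite_split V W'"
    using definite_splits_meet[OF V] by blast
  obtain Z where Z: "Z \<in> definite_split V W'" "Z \<in> definite_split U' W'"
    using change[OF V(2) UW'(1)] by blast
  have "(index_step k)\<^sup>*\<^sup>* A X" "(index_step k)\<^sup>*\<^sup>* X Y"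
    "(index_step k)\<^sup>*\<^sup>* Y Z" "(index_step k)\<^sup>*\<^sup>* Z B"
    using index_chain_definite_split UW UW' V X Y Z by metis+
  then show ?thesis by (meson rtranclp_trans)
qed

section \<open>The index integrand is extremal\<close>

text \<open>
  The spectral splitting of \<open>A\<close> still splits every nearby matrix.
\<close>

lemma index_locally_constant:
  fixes A X :: "real^'n^'n"
  assumes A: "A \<in> sym_matrices" "det A \<noteq> 0" and X: "X \<in> sym_matrices"
  obtains d where "0 < d" "\<And>t. \<bar>t\<bar> < d \<Longrightarrow> matrix_index (A + t *\<^sub>R X) = matrix_index A"
proof -
  obtain U W e where *: "complementary U W" "dim W = matrix_index A" "0 < e"
    "\<And>x. x \<in> U \<Longrightarrow> e * (x \<bullet> x) \<le> x \<bullet> (A *v x)"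
    "\<And>x. x \<in> W \<Longrightarrow> x \<bullet> (A *v x) \<le> - e * (x \<bullet> x)"
    using sym_nonsingular_spectral_split[OF A] by metis
  obtain K where K: "0 < K" "\<And>x. norm (X *v x) \<le> norm x * K"
    using bounded_linear.pos_bounded[OF matrix_vector_mul_bounded_linear[of X]] by blast
  have small: "\<bar>t * (x \<bullet> (X *v x))\<bar> < e * (x \<bullet> x)" if "\<bar>t\<bar> < e / K" "x \<noteq> 0" for t x
  proof -
    have "\<bar>x \<bullet> (X *v x)\<bar> \<le> norm x * norm (X *v x)" by (rule Cauchy_Schwarz_ineq2)
    also have "\<dots> \<le> norm x * (norm x * K)" using K(2) by (intro mult_left_mono) auto
    also have "\<dots> = K * (x \<bullet> x)" by (simp add: dot_square_norm power2_eq_square)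
    finally have "\<bar>t * (x \<bullet> (X *v x))\<bar> \<le> \<bar>t\<bar> * (K * (x \<bullet> x))"
      unfolding abs_mult by (intro mult_left_mono) auto
    also have "\<dots> = (\<bar>t\<bar> * K) * (x \<bullet> x)" by simp
    also have "\<dots> < e * (x \<bullet> x)"
      using that K(1) by (intro mult_strict_right_mono) (auto simp: pos_less_divide_eq)
    finally show ?thesis .
  qed
  have "matrix_index (A + t *\<^sub>R X) = matrix_index A" if t: "\<bar>t\<bar> < e / K" for t
  proof -
    have q: "x \<bullet> ((A + t *\<^sub>R X) *v x) = x \<bullet> (A *v x) + t * (x \<bullet> (X *v x))" for x
      by (simp add: matrix_vector_mult_add_rdistrib inner_add_right scaleR_matrix_vector_assoc[symmetric])
    have "0 < x \<bullet> ((A + t *\<^sub>R X) *v x)" if "x \<in> U" "x \<noteq> 0" for x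
      using *(4)[OF that(1)] small[OF t that(2)] unfolding q by linarith
    moreover have "x \<bullet> ((A + t *\<^sub>R X) *v x) < 0" if "x \<in> W" "x \<noteq> 0" for x
      using *(5)[OF that(1)] small[OF t that(2)] unfolding q by linarith
    ultimately have "A + t *\<^sub>R X \<in> definite_split U W"
      using sym_matrices_add_scaleR[OF A(1) X] by (simp add: definite_split_def)
    then show ?thesis using definite_split_index[OF *(1)] *(2) by simp
  qed
  moreover have "0 < e / K" using *(3) K(1) by simp
  ultimately show ?thesis using that by blast
qed

lemma index_constant_on_segment:
  fixes A X :: "real^'n^'n"
  assumes A: "A \<in> sym_matrices" and X: "X \<in> sym_matrices"
    and nz: "\<And>r. r \<in> closed_segment s t \<Longrightarrow> det (A + r *\<^sub>R X) \<noteq> 0"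
  shows "matrix_index (A + s *\<^sub>R X) = matrix_index (A + t *\<^sub>R X)"
proof -
  let ?f = "\<lambda>r. matrix_index (A + r *\<^sub>R X)"
  have "?f constant_on closed_segment s t"
  proof (rule locally_constant_imp_constant)
    fix r assume r: "r \<in> closed_segment s t"
    obtain d where d: "0 < d"
      "\<And>t. \<bar>t\<bar> < d \<Longrightarrow> matrix_index (A + r *\<^sub>R X + t *\<^sub>R X) = matrix_index (A + r *\<^sub>R X)"
      using index_locally_constant[OF sym_matrices_add_scaleR[OF A X] nz[OF r] X] by blast
    show "\<exists>T. openin (top_of_set (closed_segment s t)) T \<and> r \<in> T \<and> (\<forall>x\<in>T. ?f x = ?f r)"
    proof (intro exI conjI ballI)
      show "openin (top_of_set (closed_segment s t)) (closed_segment s t \<inter> ball r d)"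
        by (intro openin_open_Int) simp
      show "r \<in> closed_segment s t \<inter> ball r d" using r d(1) by simp
      fix x assume "x \<in> closed_segment s t \<inter> ball r d"
      then have "\<bar>x - r\<bar> < d" by (simp add: dist_real_def abs_minus_commute)
      from d(2)[OF this] show "?f x = ?f r" by (simp add: algebra_simps)
    qed
  qed simp
  then show ?thesis unfolding constant_on_def by (metis ends_in_segment)
qed

text \<open>
  The index can change only at a zero of the affine function \<open>det (A + t *\<^sub>R X)\<close>. If this function is
  constant, so is the integrand. Otherwise it has a single zero \<open>z\<close>, and the integrand is a
  non-negative combination of the positive parts of \<open>t - z\<close> and \<open>z - t\<close>.
\<close>

lemma index_integrand_convex_on_line:
  fixes A X :: "real^'n^'n"
  assumes A: "A \<in> sym_matrices" and X: "X \<in> sym_matrices" and r: "rank X \<le> 1"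
  shows "convex_on UNIV (\<lambda>t. index_integrand k (A + t *\<^sub>R X))"
proof -
  obtain u v where uv: "X = outer u v" by (rule rank_le_1_outer[OF r])
  obtain b where b: "\<And>t. det (A + t *\<^sub>R X) = det A + b * t"
    unfolding uv using det_add_outer_affine[of A u v] by blast
  let ?a = "det A"
  let ?idx = "\<lambda>t. matrix_index (A + t *\<^sub>R X)"
  have F: "index_integrand k (A + t *\<^sub>R X) = (if ?idx t = k then \<bar>?a + b * t\<bar> else 0)" for t
    by (simp add: index_integrand_def b)
  have const: "?idx s = ?idx t" if "\<And>r. r \<in> closed_segment s t \<Longrightarrow> ?a + b * r \<noteq> 0" for s t
    using that by (intro index_constant_on_segment[OF A X]) (simp add: b)
  show ?thesis
  proof (cases "b = 0")
    case True
    have "index_integrand k (A + t *\<^sub>R X) = index_integrand k A" for t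
    proof (cases "?a = 0")
      case True
      then show ?thesis using F[of t] F[of 0] \<open>b = 0\<close> by simp
    next
      case False
      then show ?thesis using F[of t] F[of 0] const[of t 0] \<open>b = 0\<close> by simp
    qed
    then show ?thesis by (simp add: convex_on_const)
  next
    case False
    define z where "z = - ?a / b"
    have ab: "?a + b * t = b * (t - z)" for t using False by (simp add: z_def field_simps)
    define p where "p = (if ?idx (z + 1) = k then \<bar>b\<bar> else 0)"
    define q where "q = (if ?idx (z - 1) = k then \<bar>b\<bar> else 0)"
    have right: "?idx t = ?idx (z + 1)" if "z < t" for t
      using that False by (intro const) (auto simp: ab closed_segment_eq_real_ivl split: if_splits)
    have left: "?idx t = ?idx (z - 1)" if "t < z" for t
      using that False by (intro const) (auto simp: ab closed_segment_eq_real_ivl split: if_splits)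
    have "index_integrand k (A + t *\<^sub>R X) = p * max (- z + 1 * t) 0 + q * max (z + (- 1) * t) 0" for t
    proof -
      consider "t < z" | "t = z" | "z < t" by linarith
      then show ?thesis
      proof cases
        case 1
        then show ?thesis unfolding F left[OF 1] ab by (simp add: q_def abs_mult)
      next
        case 2
        then show ?thesis unfolding F ab by simp
      next
        case 3
        then show ?thesis unfolding F right[OF 3] ab by (simp add: p_def abs_mult)
      qed
    qed
    moreover have "convex_on UNIV (\<lambda>t. p * max (- z + 1 * t) 0 + q * max (z + (- 1) * t) 0)"
      by (intro convex_on_add convex_on_cmul convex_on_max_affine) (simp_all add: p_def q_def)
    ultimately show ?thesis by (simp only:)
  qed
qed

text \<open>
  The affine function is \<open>det\<close> along the line with the sign that it has on the step. Up to its zero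
  no singular matrix is met, so the index remains \<open>k\<close>.
\<close>

lemma index_integrand_affine_along_step:
  fixes A B :: "real^'n^'n"
  assumes "index_step k A B"
  shows "\<exists>a b. 0 < a \<and> 0 < a + b \<and>
    (\<forall>t. 0 \<le> a + b * t \<longrightarrow> index_integrand k (A + t *\<^sub>R (B - A)) = a + b * t)"
proof -
  let ?X = "B - A"
  obtain c v where cv: "B = A + c *\<^sub>R outer v v" using assms by (auto simp: index_step_def)
  have seg: "A + t *\<^sub>R ?X \<in> sym_matrices" "det (A + t *\<^sub>R ?X) \<noteq> 0" "matrix_index (A + t *\<^sub>R ?X) = k"
    if "0 \<le> t" "t \<le> 1" for t
    using assms that by (auto simp: index_step_def)
  have A: "A \<in> sym_matrices" "det A \<noteq> 0" "matrix_index A = k" using seg[of 0] by simp_all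
  have X: "?X \<in> sym_matrices" by (simp add: cv outer_in_sym)
  have "?X = outer (c *\<^sub>R v) v" by (simp add: cv outer_simps)
  then obtain b where b: "\<And>t. det (A + t *\<^sub>R ?X) = det A + b * t"
    using det_add_outer_affine[of A "c *\<^sub>R v" v] by metis
  define s where "s = sgn (det A)"
  define \<alpha> where "\<alpha> = s * det A"
  define \<beta> where "\<beta> = s * b"
  have s: "\<bar>s\<bar> = 1" using A(2) by (simp add: s_def sgn_if)
  have \<alpha>: "0 < \<alpha>" using A(2) by (simp add: \<alpha>_def s_def sgn_if)
  have d: "\<alpha> + \<beta> * t = s * det (A + t *\<^sub>R ?X)" for t
    unfolding b by (simp add: \<alpha>_def \<beta>_def algebra_simps)
  have "0 < \<alpha> + \<beta>"
  proof (rule ccontr)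
    assume neg: "\<not> 0 < \<alpha> + \<beta>"
    define r where "r = \<alpha> / (- \<beta>)"
    have "0 \<le> r" "r \<le> 1" "\<alpha> + \<beta> * r = 0" using \<alpha> neg by (auto simp: r_def field_simps)
    with seg(2)[of r] d[of r] s show False by auto
  qed
  moreover have "index_integrand k (A + t *\<^sub>R ?X) = \<alpha> + \<beta> * t" if t: "0 \<le> \<alpha> + \<beta> * t" for t
  proof (cases "\<alpha> + \<beta> * t = 0")
    case True
    then have "det (A + t *\<^sub>R ?X) = 0" using d[of t] s by auto
    with True show ?thesis by (simp add: index_integrand_def)
  next
    case False
    have pos: "0 < \<alpha> + \<beta> * r" if "r \<in> closed_segment 0 t" for r
    proof -
      obtain l where l: "0 \<le> l" "l \<le> 1" "r = l * t"
        using \<open>r \<in> closed_segment 0 t\<close> by (auto simp: closed_segment_def)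
      have "\<alpha> + \<beta> * r = (1 - l) * \<alpha> + l * (\<alpha> + \<beta> * t)" using l(3) by (simp add: algebra_simps)
      moreover have "0 < (1 - l) * \<alpha> + l * (\<alpha> + \<beta> * t)"
        using l \<alpha> t False by (cases "l = 0") (auto intro: add_nonneg_pos)
      ultimately show ?thesis by simp
    qed
    have "matrix_index (A + 0 *\<^sub>R ?X) = matrix_index (A + t *\<^sub>R ?X)"
      using pos d by (intro index_constant_on_segment[OF A(1) X]) fastforce
    then have "index_integrand k (A + t *\<^sub>R ?X) = \<bar>det (A + t *\<^sub>R ?X)\<bar>"
      using A(3) by (simp add: index_integrand_def)
    also have "\<dots> = \<bar>\<alpha> + \<beta> * t\<bar>" using d[of t] s by (simp add: abs_mult)
    finally show ?thesis using t by simp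
  qed
  ultimately show ?thesis using \<alpha> by blast
qed

lemma index_integrand_extremal:
  "extremal_on (sym_matrices :: (real^'n^'n) set) (index_integrand k)"
proof (rule extremal_onI[where R = "index_step k"])
  show "nonneg_rank_one_convex_on (sym_matrices :: (real^'n^'n) set) (index_integrand k)"
    unfolding nonneg_rank_one_convex_on_def rank_one_convex_on_def
  proof (intro conjI ballI impI)
    show "0 \<le> index_integrand k A" for A :: "real^'n^'n" by (simp add: index_integrand_def)
  qed (simp add: index_integrand_convex_on_line)
  fix A B :: "real^'n^'n"
  show "A \<in> sym_matrices \<and> B - A \<in> sym_matrices \<and> rank (B - A) \<le> 1 \<and>
      (\<exists>a b. 0 < a \<and> 0 < a + b \<and>
        (\<forall>t. 0 \<le> a + b * t \<longrightarrow> index_integrand k (A + t *\<^sub>R (B - A)) = a + b * t))"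
    if R: "index_step k A B"
  proof (intro conjI index_integrand_affine_along_step[OF R])
    obtain c v where "B - A = c *\<^sub>R outer v v" using R by (auto simp: index_step_def)
    then show "B - A \<in> sym_matrices" "rank (B - A) \<le> 1"
      using outer_in_sym rank_outer_le by (metis outer_simps(1))+
    have "A + 0 *\<^sub>R (B - A) \<in> sym_matrices"
      using R unfolding index_step_def by (metis atLeastAtMost_iff order_refl zero_le_one)
    then show "A \<in> sym_matrices" by simp
  qed
  show "(index_step k)\<^sup>*\<^sup>* A B" if "A \<in> sym_matrices" "B \<in> sym_matrices"
    "0 < index_integrand k A" "0 < index_integrand k B"
    using that by (intro index_chain_connected) (auto simp: index_integrand_def split: if_splits)
qed (rule sym_matrices_add_scaleR)

theorem theorem1p1:
  fixes i j :: "'s::{finite,linorder} \<Rightarrow> 'n::{finite,linorder}"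
  shows "(strict_mono i \<and> strict_mono j \<longrightarrow>
           extremal_on UNIV (\<lambda>A. max (minor i j A) 0) \<and>
           extremal_on UNIV (\<lambda>A. max (- minor i j A) 0)) \<and>
         (\<forall>k\<in>{0..CARD('n)}.
           extremal_on (sym_matrices :: (real^'n::{finite,linorder}^'n::{finite,linorder}) set)
             (index_integrand k))"
  using minor_part_extremal[of i j 1] minor_part_extremal[of i j "-1"] index_integrand_extremal
  by (auto dest: strict_mono_imp_inj_on)

end
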